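(* Fix $0<\delta<\frac12$. Let $\{X_n, n\ge1\}$ be independent and identically distributed random variables with values in a countably infinite alphabet $\mathcal{A}=\{a_i: i\ge1\}$ and common nonuniform distribution $\{p_i, i\ge1\}$, $p_i=\mathbb{P}(X_1=a_i)$, satisfying $\mathbb{E}|\ln p(X_1)|^{2+\delta}<\infty$. Assume that there exist a positive-integer-valued function $K(n)$ and a constant $C_0$ such that for all $n\ge1$ $$K(n)\le n^{\frac12-\delta},\qquad n^{\frac12+\delta}\ln n\sum_{i=K(n)}^\infty p_i\le C_0,\qquad -n^{\frac12+\delta}\sum_{i=K(n)}^\infty p_i\ln p_i\le C_0.$$ Let $H=-\sum_{i=1}^\infty p_i\ln p_i$, let $\hat H_n=-\sum_{i=1}^\infty\hat p_i\ln\hat p_i$ with $\hat p_i=\frac1n\sum_{k=1}^n I_{\{X_k=a_i\}}$, and let $\sigma^2=\mathrm{Var}(\ln p(X_1))$, $\sigma>0$. Then there is a constant $C>0$, not depending on $n$, such that for every $n\ge1$, $$\sup_{x\in\mathbb{R}}\left|\mathbb{P}\left(\frac{\sqrt n(\hat H_n-H)}{\sigma}<x\right)-\Phi(x)\right|\le C n^{-\frac{\delta}{2}},$$ where $\Phi$ is the standard normal distribution function.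
   Context: $p(X_1)$ denotes the random variable equal to $p_i$ on the event $\{X_1=a_i\}$. Some $p_i$ may be zero; the convention $0\ln 0=0$ is used. "Nonuniform" means that the positive $p_i$ are not all equal, equivalently $\mathrm{Var}(\ln p(X_1))>0$. $I_A$ denotes the indicator of the event $A$; the quantities $\hat p_i$ depend on $n$. *)

theory Defs
  imports "HOL-Probability.Probability"
begin

text \<open>The probability that \<open>Y\<close> takes the value \<open>y\<close>. With \<open>p\<^sub>i = point_prob M (X 1) (a i)\<close>, the random
  variable \<open>p(X\<^sub>1)\<close>, equal to \<open>p\<^sub>i\<close> on the event \<open>X\<^sub>1 = a\<^sub>i\<close>, is \<open>\<lambda>\<omega>. point_prob M (X 1) (X 1 \<omega>)\<close>.\<close>

definition point_prob :: "'w measure \<Rightarrow> ('w \<Rightarrow> 'b) \<Rightarrow> 'b \<Rightarrow> real" where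
  "point_prob M Y y = measure M {\<omega> \<in> space M. Y \<omega> = y}"

definition empirical_freq :: "(nat \<Rightarrow> 'w \<Rightarrow> 'b) \<Rightarrow> nat \<Rightarrow> 'w \<Rightarrow> 'b \<Rightarrow> real" where
  "empirical_freq X n \<omega> y = (1 / real n) * (\<Sum>k=1..n. indicator {\<omega>'. X k \<omega>' = y} \<omega>)"

text \<open>The convention \<open>0 ln 0 = 0\<close> holds automatically. All terms have the same sign when
  \<open>0 \<le> q i \<le> 1\<close>, so the unordered sum is the usual series. It is used only where it converges:
  empirical frequencies have finite support, and the moment assumption on \<open>ln p(X\<^sub>1)\<close> makes
  \<open>p\<^sub>i ln p\<^sub>i\<close> summable.\<close>

definition series_entropy :: "(nat \<Rightarrow> real) \<Rightarrow> real" where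
  "series_entropy q = - (\<Sum>\<^sub>\<infinity>i\<in>{1..}. q i * ln (q i))"

definition plugin_entropy :: "(nat \<Rightarrow> 'b) \<Rightarrow> (nat \<Rightarrow> 'w \<Rightarrow> 'b) \<Rightarrow> nat \<Rightarrow> 'w \<Rightarrow> real" where
  "plugin_entropy a X n \<omega> = series_entropy (\<lambda>i. empirical_freq X n \<omega> (a i))"

end

theory Submission
  imports Defs
begin

text \<open>
  The plug-in entropy splits as \<open>H_n = (1/n) \<Sum>\<^sub>k (- ln p(X\<^sub>k)) - D_n\<close>, where \<open>D_n \<ge> 0\<close> is the Kullback--Leibler
  divergence of the empirical distribution from \<open>p\<close>. The first term is a sum of i.i.d. variables
  with \<open>2 + \<delta>\<close> moments, to which a Berry--Esseen bound of order \<open>n powr (- \<delta>/2)\<close> applies. For the second,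
  \<open>ln x \<le> x - 1\<close> on the letters with index below \<open>K(n)\<close> and \<open>ln x \<le> 0\<close> for the empirical frequencies of the
  others give \<open>E D_n \<le> K(n)/n - (\<Sum>i\<ge>K(n). p\<^sub>i ln p\<^sub>i) = O(n powr (- 1/2 - \<delta>))\<close>, so by Markov's inequality
  \<open>sqrt n * D_n\<close> exceeds \<open>n powr (- \<delta>/2)\<close> with probability \<open>O(n powr (- \<delta>/2))\<close>.

  Since the rate \<open>\<delta>/2\<close> is at most \<open>1/4\<close>, the Berry--Esseen bound can be obtained by smoothing with a
  Gaussian of standard deviation \<open>n powr (- \<delta>/2)\<close> rather than with a kernel whose characteristic
  function has compact support: the frequencies beyond \<open>c sqrt n\<close>, where the characteristic function
  of the sum is not controlled, contribute only \<open>O(n powr (- 1/2 + \<delta>/2))\<close>.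
\<close>

section \<open>Smoothing and characteristic functions\<close>

lemma (in real_distribution) cdf_measurable [measurable]: "cdf M \<in> borel_measurable borel"
  by (intro borel_measurable_mono monoI cdf_nondecreasing)

lemma real_distribution_convolution:
  assumes "real_distribution M" "real_distribution N"
  shows "real_distribution (M \<star> N)"
proof -
  interpret M: real_distribution M by fact
  interpret N: real_distribution N by fact
  interpret pair_prob_space M N ..
  show ?thesis
    unfolding convolution_def by (rule real_distribution_distr) simp
qed

lemma char_convolution:
  assumes "real_distribution M" "real_distribution N"
  shows "char (M \<star> N) t = char M t * char N t"
proof -
  interpret M: real_distribution M by fact
  interpret N: real_distribution N by fact
  interpret pair_prob_space M N ..
  have int: "integrable (M \<Otimes>\<^sub>M N) (\<lambda>(x, y). iexp (t * x) * iexp (t * y))"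
    by (rule integrable_const_bound[where B=1]) (auto simp: norm_mult)
  have "char (M \<star> N) t = (CLINT z|M \<Otimes>\<^sub>M N. (case z of (x, y) \<Rightarrow> iexp (t * x) * iexp (t * y)))"
    unfolding char_def convolution_def
    by (subst integral_distr) (auto intro!: Bochner_Integration.integral_cong
        simp: ring_distribs exp_add split_beta)
  also have "\<dots> = (CLINT x|M. (CLINT y|N. iexp (t * x) * iexp (t * y)))"
    by (rule integral_fst'[OF int, symmetric, unfolded split_conv])
  also have "\<dots> = char M t * char N t"
    unfolding char_def by simp
  finally show ?thesis .
qed

lemma cdf_convolution:
  assumes "real_distribution V" "real_distribution M"
  shows "cdf (V \<star> M) x = (LINT v|V. cdf M (x - v))"
proof -
  interpret V: real_distribution V by fact
  interpret M: real_distribution M by fact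
  have "emeasure (V \<star> M) {..x} = (\<integral>\<^sup>+v. emeasure M {a. a + v \<in> {..x}} \<partial>V)"
    by (rule convolution_emeasure) (auto simp: V.finite_measure_axioms M.finite_measure_axioms)
  also have "\<dots> = (\<integral>\<^sup>+v. ennreal (cdf M (x - v)) \<partial>V)"
    by (intro nn_integral_cong)
      (auto simp: cdf_def M.emeasure_eq_measure atMost_def le_diff_eq)
  finally have "emeasure (V \<star> M) {..x} = (\<integral>\<^sup>+v. ennreal (cdf M (x - v)) \<partial>V)" .
  moreover have "(\<lambda>v. cdf M (x - v)) \<in> borel_measurable V"
    by measurable
  ultimately show ?thesis
    by (subst integral_eq_nn_integral) (auto simp: cdf_def measure_def)
qed

text \<open>If the distribution functions differ by nearly \<open>\<eta>\<close>, the largest possible value, at \<open>z\<close>, then they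
  still differ by nearly \<open>\<eta> - 2 m b\<close> on an interval of length \<open>2 b\<close> to the right or left of \<open>z\<close>, on which
  the suitably shifted kernel puts most of its mass.\<close>

lemma cdf_diff_le_smoothed_cdf_diff:
  assumes "real_distribution V" "real_distribution M" "real_distribution N"
    and smoothed: "\<And>x. \<bar>cdf (V \<star> M) x - cdf (V \<star> N) x\<bar> \<le> \<Delta>"
    and lipschitz: "\<And>x y. x \<le> y \<Longrightarrow> cdf N y - cdf N x \<le> m * (y - x)"
    and b: "0 \<le> b" and mass: "measure V {-b..b} \<ge> 3/4"
  shows "\<bar>cdf M x - cdf N x\<bar> \<le> 2 * \<Delta> + 3 * m * b"
proof -
  interpret V: real_distribution V by fact
  interpret M: real_distribution M by fact
  interpret N: real_distribution N by fact
  define D where "D z = cdf M z - cdf N z" for z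
  define \<eta> where "\<eta> = (SUP z. \<bar>D z\<bar>)"
  have D_le_1: "\<bar>D z\<bar> \<le> 1" for z
    using M.cdf_nonneg[of z] N.cdf_nonneg[of z] M.cdf_bounded_prob[of z] N.cdf_bounded_prob[of z]
    by (auto simp: D_def abs_le_iff)
  have le_eta: "\<bar>D z\<bar> \<le> \<eta>" for z
    unfolding \<eta>_def by (rule cSUP_upper) (auto intro!: bdd_aboveI[of _ 1] D_le_1)
  have m: "0 \<le> m"
    using lipschitz[of 0 1] N.cdf_nondecreasing[of 0 1] by simp
  have Delta: "0 \<le> \<Delta>"
    using smoothed[of 0] by linarith
  have intM: "integrable V (\<lambda>v. cdf M (z - v))" for z
    using M.cdf_nonneg M.cdf_bounded_prob by (intro V.integrable_const_bound[where B=1]) auto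
  have intN: "integrable V (\<lambda>v. cdf N (z - v))" for z
    using N.cdf_nonneg N.cdf_bounded_prob by (intro V.integrable_const_bound[where B=1]) auto
  have intD: "integrable V (\<lambda>v. D (z - v))" for z
    unfolding D_def using intM intN by simp
  have smoothed': "\<bar>LINT v|V. D (z - v)\<bar> \<le> \<Delta>" for z
    using smoothed[of z] unfolding D_def
    by (simp add: cdf_convolution assms(1,2,3) intM intN)
  define I where "I = {-b..b}"
  have [measurable]: "I \<in> sets borel"
    by (simp add: I_def)
  have mass': "V.prob (- I) = 1 - V.prob I"
    using V.prob_compl[of I] by (simp add: I_def Compl_eq_Diff_UNIV)
  have int_bound: "(LINT v|V. (c * indicator I v - \<eta> * indicator (- I) v)) = c * V.prob I - \<eta> * (1 - V.prob I)" for c :: real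
    by (subst Bochner_Integration.integral_diff) (auto simp: mass' V.emeasure_eq_measure)
  have int: "integrable V (\<lambda>v. (c * indicator I v - \<eta> * indicator (- I) v))" for c :: real
    by (auto simp: V.emeasure_eq_measure)
  \<comment> \<open>For positive \<open>c\<close>, mass at least \<open>3/4\<close> on
    \<open>I\<close> gives \<open>3/4 * c \<le> \<Delta> + \<eta> / 4\<close>. The case
    \<open>c \<le> 0\<close> is separate because there the lower bound on the mass cannot be
    multiplied by \<open>c\<close>.\<close>
  have final: "c \<le> 4/3 * \<Delta> + \<eta> / 3" if "c * V.prob I - \<eta> * (1 - V.prob I) \<le> \<Delta>" for c
  proof (cases "c \<le> 0")
    case True
    then show ?thesis using Delta le_eta[of 0] by linarith
  next
    case False
    have "c * (3/4) \<le> c * V.prob I"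
      using False mass by (intro mult_left_mono) (auto simp: I_def)
    moreover have "\<eta> * (1 - V.prob I) \<le> \<eta> * (1/4)"
      using le_eta[of 0] mass by (intro mult_left_mono) (auto simp: I_def)
    ultimately show ?thesis using that by linarith
  qed
  have upper: "D z \<le> 2 * m * b + 4/3 * \<Delta> + \<eta> / 3" for z
  proof -
    \<comment> \<open>Shifting by \<open>b\<close> places \<open>z + b - v\<close> in
      \<open>{z..z + 2 * b}\<close> for every \<open>v\<close> in \<open>I\<close>. There
      \<open>cdf M\<close> has not decreased and \<open>cdf N\<close> has grown by at most
      \<open>2 * m * b\<close>. Off \<open>I\<close> only the global bound
      \<open>- \<eta> \<le> D\<close> is available.\<close>
    have "(D z - 2 * m * b) * indicator I v - \<eta> * indicator (- I) v \<le> D (z + b - v)" for v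
    proof (cases "v \<in> I")
      case True
      have "cdf N (z + b - v) - cdf N z \<le> m * (b - v)"
        using lipschitz[of z "z + b - v"] True by (simp add: I_def algebra_simps)
      also have "\<dots> \<le> m * (2 * b)"
        using m True by (intro mult_left_mono) (auto simp: I_def)
      finally show ?thesis
        using True M.cdf_nondecreasing[of z "z + b - v"] by (simp add: D_def I_def)
    next
      case False
      then show ?thesis using le_eta[of "z + b - v"] by simp
    qed
    hence "(D z - 2 * m * b) * V.prob I - \<eta> * (1 - V.prob I) \<le> (LINT v|V. D (z + b - v))"
      unfolding int_bound[symmetric] by (intro integral_mono int intD)
    also have "\<dots> \<le> \<Delta>"
      using smoothed'[of "z + b"] by linarith
    finally show ?thesis using final[of "D z - 2 * m * b"] by linarith
  qed
  have lower: "- D z \<le> 2 * m * b + 4/3 * \<Delta> + \<eta> / 3" for z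
  proof -
    \<comment> \<open>The mirror image: the opposite shift places \<open>z - b - v\<close> in
      \<open>{z - 2 * b..z}\<close>.\<close>
    have "(- D z - 2 * m * b) * indicator I v - \<eta> * indicator (- I) v \<le> - D (z - b - v)" for v
    proof (cases "v \<in> I")
      case True
      have "cdf N z - cdf N (z - b - v) \<le> m * (b + v)"
        using lipschitz[of "z - b - v" z] True by (simp add: I_def algebra_simps)
      also have "\<dots> \<le> m * (2 * b)"
        using m True by (intro mult_left_mono) (auto simp: I_def)
      finally show ?thesis
        using True M.cdf_nondecreasing[of "z - b - v" z] by (simp add: D_def I_def)
    next
      case False
      then show ?thesis using le_eta[of "z - b - v"] by simp
    qed
    hence "(- D z - 2 * m * b) * V.prob I - \<eta> * (1 - V.prob I) \<le> (LINT v|V. - D (z - b - v))"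
      unfolding int_bound[symmetric] by (intro integral_mono int integrable_minus intD)
    also have "\<dots> \<le> \<Delta>"
      using smoothed'[of "z - b"] by simp
    finally show ?thesis using final[of "- D z - 2 * m * b"] by linarith
  qed
  \<comment> \<open>Since \<open>\<eta>\<close> is finite, the term \<open>\<eta> / 3\<close> can be
    absorbed on the left. Multiplying the remaining \<open>2/3 * \<eta>\<close> by
    \<open>3/2\<close> yields the constants \<open>2\<close> and \<open>3\<close> of the
    claim.\<close>
  have "\<eta> \<le> 2 * m * b + 4/3 * \<Delta> + \<eta> / 3"
    unfolding \<eta>_def by (intro cSUP_least) (use upper lower in \<open>auto simp: abs_le_iff \<eta>_def\<close>)
  thus ?thesis
    using le_eta[of x] by (simp add: D_def)
qed

text \<open>Levy inversion over \<open>{a<..x}\<close> expresses both interval probabilities through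
  characteristic functions; atomlessness makes it valid for all endpoints. Bounding the difference
  of the two integrals by a quantity independent of \<open>a\<close> allows \<open>a\<close> to tend
  to minus infinity.\<close>

lemma cdf_diff_le_char_diff:
  assumes "real_distribution M" "real_distribution N"
    and atomless: "\<And>x. measure M {x} = 0" "\<And>x. measure N {x} = 0"
    and w: "integrable lborel w"
    and le_w: "\<And>t. norm (char M t - char N t) / \<bar>t\<bar> \<le> w t"
  shows "\<bar>cdf M x - cdf N x\<bar> \<le> (LINT t|lborel. w t) / pi"
proof -
  interpret M: real_distribution M by fact
  interpret N: real_distribution N by fact
  let ?F = "\<lambda>a t. (iexp (-(t * a)) - iexp (-(t * x))) / (\<i> * t)"
  have bound: "\<bar>measure M {a<..x} - measure N {a<..x}\<bar> \<le> (LINT t|lborel. w t) / pi" if "a < x" for a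
  proof -
    let ?G = "\<lambda>P T. 1 / (2 * pi) * (CLBINT t=ereal (-T)..ereal T. ?F a t * char P t)"
    \<comment> \<open>This bound serves integrability on bounded intervals, in particular near
      \<open>t = 0\<close>; at \<open>t = 0\<close> itself division by zero makes the kernel
      vanish.\<close>
    have F_le: "norm (?F a t) \<le> x - a" for t
      using Levy_Inversion_aux2[of "-x" "-a" t] that
      by (cases "t = 0") (auto simp: algebra_simps)
    have int: "integrable lborel (\<lambda>t. indicator {-T<..<T} t *\<^sub>R (?F a t * char P t))"
      if "real_distribution P" for P and T :: real
    proof -
      interpret P: real_distribution P by fact
      have "norm (?F a t * char P t) \<le> x - a" for t
        using mult_mono[OF F_le[of t] P.cmod_char_le_1[of t]] \<open>a < x\<close> by (simp only: norm_mult) simp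
      thus ?thesis
        using emeasure_bounded_finite[of "{-T<..<T}"]
        by (intro integrableI_bounded_set_indicator[where B="x - a"]) auto
    qed
    hence int': "interval_lebesgue_integrable lborel (ereal (-T)) (ereal T) (\<lambda>t. ?F a t * char P t)"
      if "real_distribution P" "T \<ge> 0" for P and T :: real
      using that by (auto simp: interval_lebesgue_integrable_def set_integrable_def simp del: times_divide_eq_left)
    have "(\<lambda>T. ?G M (real T) - ?G N (real T)) \<longlonglongrightarrow> of_real (measure M {a<..x}) - of_real (measure N {a<..x})"
      using that by (intro tendsto_diff M.Levy_Inversion[unfolded of_int_minus of_int_of_nat_eq]
          N.Levy_Inversion[unfolded of_int_minus of_int_of_nat_eq] atomless less_imp_le) 
    hence lim: "(\<lambda>T. norm (?G M (real T) - ?G N (real T))) \<longlonglongrightarrow> \<bar>measure M {a<..x} - measure N {a<..x}\<bar>"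
      by (drule_tac tendsto_norm) (simp flip: of_real_diff)
    have "norm (?G M (real T) - ?G N (real T)) \<le> (LINT t|lborel. w t) / pi" for T :: nat
    proof -
      have "?G M (real T) - ?G N (real T) =
          1 / (2 * pi) * ((CLBINT t=ereal (-real T)..ereal (real T). ?F a t * char M t) - (CLBINT t=ereal (-real T)..ereal (real T). ?F a t * char N t))"
        by (simp add: right_diff_distrib)
      also have "(CLBINT t=ereal (-real T)..ereal (real T). ?F a t * char M t) - (CLBINT t=ereal (-real T)..ereal (real T). ?F a t * char N t)
          = (CLBINT t=ereal (-real T)..ereal (real T). ?F a t * char M t - ?F a t * char N t)"
        using int'[OF assms(1), of T] int'[OF assms(2), of T]
        by (subst interval_lebesgue_integral_diff) auto
      also have "\<dots> = (CLINT t|lborel. indicator {-real T<..<real T} t *\<^sub>R (?F a t * (char M t - char N t)))"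
        by (simp add: interval_lebesgue_integral_def set_lebesgue_integral_def right_diff_distrib)
      finally have "norm (?G M (real T) - ?G N (real T)) = 1 / (2 * pi) *
         norm (CLINT t|lborel. indicator {-real T<..<real T} t *\<^sub>R (?F a t * (char M t - char N t)))"
        by (simp add: norm_mult norm_divide)
      also have "norm (CLINT t|lborel. indicator {-real T<..<real T} t *\<^sub>R (?F a t * (char M t - char N t)))
          \<le> (LINT t|lborel. 2 * w t)"
      proof (rule Bochner_Integration.integral_norm_bound_integral)
        show "integrable lborel (\<lambda>t. indicator {-real T<..<real T} t *\<^sub>R (?F a t * (char M t - char N t)))"
          unfolding right_diff_distrib scaleR_right_diff_distrib
          by (intro Bochner_Integration.integrable_diff int assms(1,2))
        show "integrable lborel (\<lambda>t. 2 * w t)" using w by simp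
        fix t :: real
        have w_nonneg: "0 \<le> w t"
          by (rule order_trans[OF _ le_w]) auto
        \<comment> \<open>For the estimate itself the numerator of the kernel is bounded by
          \<open>2\<close>, uniformly in \<open>a\<close>. Together with the prefactor
          \<open>1 / (2 * pi)\<close> this produces \<open>1 / pi\<close>.\<close>
        have "norm (?F a t * (char M t - char N t)) \<le> 2 * (norm (char M t - char N t) / \<bar>t\<bar>)"
        proof -
          have "norm (iexp (-(t * a)) - iexp (-(t * x))) \<le> 2"
            using norm_triangle_ineq4[of "iexp (-(t * a))" "iexp (-(t * x))"] by (simp only: norm_exp_i_times)
          hence "norm (iexp (-(t * a)) - iexp (-(t * x))) * (norm (char M t - char N t) / \<bar>t\<bar>)
              \<le> 2 * (norm (char M t - char N t) / \<bar>t\<bar>)"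
            by (intro mult_right_mono) auto
          thus ?thesis by (simp add: norm_mult norm_divide)
        qed
        also have "\<dots> \<le> 2 * w t" using le_w[of t] by simp
        finally show "norm (indicator {-real T<..<real T} t *\<^sub>R (?F a t * (char M t - char N t))) \<le> 2 * w t"
          using w_nonneg by (auto split: split_indicator)
      qed
      finally show ?thesis by (simp add: field_simps)
    qed
    thus ?thesis
      by (intro LIMSEQ_le_const2[OF lim]) auto
  qed
  have "(\<lambda>i. \<bar>(cdf M x - cdf M (- real i)) - (cdf N x - cdf N (- real i))\<bar>) \<longlonglongrightarrow> \<bar>(cdf M x - 0) - (cdf N x - 0)\<bar>"
    by (intro tendsto_intros M.cdf_lim_neg_infty N.cdf_lim_neg_infty)
  moreover have "\<forall>\<^sub>F i in sequentially. \<bar>(cdf M x - cdf M (- real i)) - (cdf N x - cdf N (- real i))\<bar> \<le> (LINT t|lborel. w t) / pi"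
    using eventually_gt_at_top[of "nat \<lceil>-x\<rceil>"]
  proof eventually_elim
    case (elim i)
    hence "- real i < x" by linarith
    thus ?case using bound[of "- real i"] by (simp add: M.cdf_diff_eq N.cdf_diff_eq)
  qed
  ultimately show ?thesis
    by (intro tendsto_upperbound[of _ _ sequentially]) auto
qed

section \<open>Characteristic functions of normalized sums\<close>

text \<open>Division by \<open>r\<close> moves both elements into the unit ball, where
  \<open>norm_power_diff\<close> applies. The factor \<open>r ^ (n - 1)\<close> is what later
  carries the Gaussian decay of the characteristic functions.\<close>

lemma norm_power_diff_le:
  fixes z w :: "'a::{real_normed_algebra_1, comm_monoid_mult}"
  assumes "norm z \<le> r" "norm w \<le> r" "0 < r"
  shows "norm (z ^ n - w ^ n) \<le> real n * r ^ (n - 1) * norm (z - w)"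
proof (cases n)
  case (Suc m)
  have scale: "(y /\<^sub>R r) ^ n = y ^ n /\<^sub>R r ^ n" for y :: 'a
    by (simp add: scaleR_power power_inverse)
  have "norm ((z /\<^sub>R r) ^ n - (w /\<^sub>R r) ^ n) \<le> real n * norm (z /\<^sub>R r - w /\<^sub>R r)"
    using assms by (intro norm_power_diff) (auto simp: divide_simps)
  hence "norm (z ^ n - w ^ n) / r ^ n \<le> real n * (norm (z - w) / r)"
    using assms by (simp add: scale flip: scaleR_diff_right) (simp add: field_simps)
  thus ?thesis
    using assms by (simp add: Suc field_simps)
qed simp

lemma abs_exp_minus_taylor1:
  fixes u :: real
  assumes "0 \<le> u"
  shows "\<bar>exp (- u) - (1 - u)\<bar> \<le> u\<^sup>2"
proof -
  have "exp (- u) \<le> 1 / (1 + u)"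
    using exp_ge_add_one_self[of u] assms by (simp add: exp_minus field_simps)
  also have "\<dots> \<le> 1 - u + u\<^sup>2"
  proof -
    have "0 \<le> u * (u * u)" using assms by simp
    hence "1 \<le> (1 - u + u\<^sup>2) * (1 + u)" by (simp add: algebra_simps power2_eq_square)
    thus ?thesis using assms by (simp add: divide_le_eq)
  qed
  finally show ?thesis
    using exp_ge_add_one_self[of "- u"] by simp
qed

lemma (in finite_measure) square_integrable_of_powr:
  fixes f :: "'a \<Rightarrow> real"
  assumes [measurable]: "f \<in> borel_measurable M"
    and "0 \<le> \<delta>" and "integrable M (\<lambda>x. \<bar>f x\<bar> powr (2 + \<delta>))"
  shows "integrable M (\<lambda>x. (f x)\<^sup>2)"
proof (rule Bochner_Integration.integrable_bound)
  show "integrable M (\<lambda>x. 1 + \<bar>f x\<bar> powr (2 + \<delta>))"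
    using assms by simp
  have "y\<^sup>2 \<le> 1 + \<bar>y\<bar> powr (2 + \<delta>)" for y :: real
  proof (cases "\<bar>y\<bar> \<le> 1")
    case True
    then have "y\<^sup>2 \<le> 1" by (simp add: abs_square_le_1)
    then show ?thesis by (simp add: add_increasing2)
  next
    case False
    then have "\<bar>y\<bar> powr 2 \<le> \<bar>y\<bar> powr (2 + \<delta>)"
      using assms by (intro powr_mono) auto
    then show ?thesis using False by simp
  qed
  thus "AE x in M. norm ((f x)\<^sup>2) \<le> norm (1 + \<bar>f x\<bar> powr (2 + \<delta>))"
    by (intro AE_I2) (simp add: add_nonneg_nonneg)
qed simp

text \<open>The law of one centered summand, later that of
  \<open>- ln (q (J 1 \<omega>)) - H\<close>. The range \<open>0 < \<delta> \<le> 1\<close> is where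
  \<open>\<bar>x\<bar> powr (2 + \<delta>)\<close> interpolates between the square and the
  cube.\<close>

locale centered_distribution = real_distribution +
  fixes \<delta> \<sigma> :: real
  assumes delta: "0 < \<delta>" "\<delta> \<le> 1"
    and sigma: "0 < \<sigma>"
    and moment: "integrable M (\<lambda>x. \<bar>x\<bar> powr (2 + \<delta>))"
    and mean: "expectation (\<lambda>x. x) = 0"
    and var: "variance (\<lambda>x. x) = \<sigma>\<^sup>2"
begin

text \<open>The remainder of the second-order expansion is controlled by the smaller of a quadratic
  and a cubic term. The quadratic one is used where \<open>\<bar>s * x\<bar> > 1\<close> and the
  cubic one elsewhere; both are dominated by the intermediate power
  \<open>2 + \<delta>\<close>.\<close>

lemma char_taylor2:
  "norm (char M s - (1 - s\<^sup>2 * \<sigma>\<^sup>2 / 2)) \<le> expectation (\<lambda>x. \<bar>x\<bar> powr (2 + \<delta>)) * \<bar>s\<bar> powr (2 + \<delta>)"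
proof -
  have int2: "integrable M (\<lambda>x. x\<^sup>2)"
    by (rule square_integrable_of_powr[where f="\<lambda>x. x" and \<delta>=\<delta>]) (use delta moment in simp_all)
  have int1: "integrable M (\<lambda>x. x)"
    by (rule square_integrable_imp_integrable) (use int2 in simp_all)
  have le: "min (6 * x\<^sup>2) (\<bar>s\<bar> * \<bar>x\<bar> ^ 3) \<le> 6 * \<bar>s\<bar> powr \<delta> * \<bar>x\<bar> powr (2 + \<delta>)" for x
  proof -
    have eq: "\<bar>s\<bar> powr \<delta> * \<bar>x\<bar> powr (2 + \<delta>) = x\<^sup>2 * \<bar>s * x\<bar> powr \<delta>"
      by (cases "x = 0") (auto simp: powr_add powr_mult abs_mult)
    show ?thesis
    proof (cases "\<bar>s * x\<bar> \<le> 1")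
      case True
      have "\<bar>s * x\<bar> powr 1 \<le> \<bar>s * x\<bar> powr \<delta>"
        using True delta by (intro powr_mono') auto
      hence "x\<^sup>2 * \<bar>s * x\<bar> \<le> x\<^sup>2 * \<bar>s * x\<bar> powr \<delta>"
        by (intro mult_left_mono) simp_all
      hence "x\<^sup>2 * \<bar>s * x\<bar> \<le> 6 * (x\<^sup>2 * \<bar>s * x\<bar> powr \<delta>)"
        using mult_nonneg_nonneg[OF zero_le_power2[of x] powr_ge_zero[of "\<bar>s * x\<bar>" \<delta>]] by linarith
      moreover have "\<bar>s\<bar> * \<bar>x\<bar> ^ 3 = x\<^sup>2 * \<bar>s * x\<bar>"
        by (simp add: abs_mult power3_eq_cube power2_eq_square)
      ultimately show ?thesis
        using eq by (intro min.coboundedI2) (simp only: mult.assoc)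
    next
      case False
      hence "1 \<le> \<bar>s * x\<bar> powr \<delta>"
        using delta by (intro ge_one_powr_ge_zero) auto
      hence "x\<^sup>2 * 1 \<le> x\<^sup>2 * \<bar>s * x\<bar> powr \<delta>"
        by (rule mult_left_mono) simp
      hence "6 * x\<^sup>2 \<le> 6 * (\<bar>s\<bar> powr \<delta> * \<bar>x\<bar> powr (2 + \<delta>))"
        unfolding eq by simp
      then show ?thesis
        by (intro min.coboundedI1) (simp only: mult.assoc)
    qed
  qed
  have "norm (char M s - (1 - s\<^sup>2 * \<sigma>\<^sup>2 / 2))
      \<le> s\<^sup>2 / 6 * expectation (\<lambda>x. min (6 * x\<^sup>2) (\<bar>s\<bar> * \<bar>x\<bar> ^ 3))"
    using char_approx3[OF int1 mean int2 var, of s] by simp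
  also have "\<dots> \<le> s\<^sup>2 / 6 * expectation (\<lambda>x. 6 * \<bar>s\<bar> powr \<delta> * \<bar>x\<bar> powr (2 + \<delta>))"
  proof (intro mult_left_mono integral_mono le)
    show "integrable M (\<lambda>x. min (6 * x\<^sup>2) (\<bar>s\<bar> * \<bar>x\<bar> ^ 3))"
      by (rule Bochner_Integration.integrable_bound[OF integrable_mult_right[of 6, OF int2]]) auto
    show "integrable M (\<lambda>x. 6 * \<bar>s\<bar> powr \<delta> * \<bar>x\<bar> powr (2 + \<delta>))"
      using moment by (rule integrable_mult_right)
  qed simp
  also have "\<dots> = s\<^sup>2 * \<bar>s\<bar> powr \<delta> * expectation (\<lambda>x. \<bar>x\<bar> powr (2 + \<delta>))"
    by simp
  also have "s\<^sup>2 * \<bar>s\<bar> powr \<delta> = \<bar>s\<bar> powr (2 + \<delta>)"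
    by (cases "s = 0") (auto simp: powr_add)
  finally show ?thesis by (simp add: mult.commute)
qed

text \<open>Close to zero the Taylor error is at most half of the quadratic term
  \<open>(\<sigma> * s)\<^sup>2 / 2\<close>, so decay at half the Gaussian rate survives. The
  Gaussian has the same quadratic expansion, with an error of order \<open>s ^ 4\<close>, which is
  smaller than the order \<open>2 + \<delta>\<close>.\<close>

lemma char_near_zero:
  obtains c L where "0 < c" "0 < L"
    and "\<And>s. \<bar>s\<bar> \<le> c \<Longrightarrow> norm (char M s) \<le> exp (- (\<sigma> * s)\<^sup>2 / 4)"
    and "\<And>s. \<bar>s\<bar> \<le> c \<Longrightarrow> norm (char M s - exp (- (\<sigma> * s)\<^sup>2 / 2)) \<le> L * \<bar>s\<bar> powr (2 + \<delta>)"
proof -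
  define L where "L = expectation (\<lambda>x. \<bar>x\<bar> powr (2 + \<delta>))"
  have L: "0 \<le> L" unfolding L_def by simp
  \<comment> \<open>The bound \<open>1\<close> gives
    \<open>s ^ 4 \<le> \<bar>s\<bar> powr (2 + \<delta>)\<close>, the bound
    \<open>1 / \<sigma>\<close> keeps \<open>1 - (\<sigma> * s)\<^sup>2 / 2\<close> nonnegative, and
    the last one gives \<open>L * \<bar>s\<bar> powr \<delta> \<le> \<sigma>\<^sup>2 / 4\<close>.
    Using \<open>L + 1\<close> excludes a zero denominator.\<close>
  define c where "c = min 1 (min (1 / \<sigma>) ((\<sigma>\<^sup>2 / (4 * (L + 1))) powr (1 / \<delta>)))"
  have c: "0 < c" "c \<le> 1" "c \<le> 1 / \<sigma>" "c \<le> (\<sigma>\<^sup>2 / (4 * (L + 1))) powr (1 / \<delta>)"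
    using L sigma by (auto simp: c_def)
  have small: "L * \<bar>s\<bar> powr \<delta> \<le> \<sigma>\<^sup>2 / 4" if "\<bar>s\<bar> \<le> c" for s
  proof -
    have "\<bar>s\<bar> powr \<delta> \<le> ((\<sigma>\<^sup>2 / (4 * (L + 1))) powr (1 / \<delta>)) powr \<delta>"
      using that c delta by (intro powr_mono2) auto
    also have "\<dots> = \<sigma>\<^sup>2 / (4 * (L + 1))"
      using L delta sigma by (simp add: powr_powr)
    finally have "L * \<bar>s\<bar> powr \<delta> \<le> L * (\<sigma>\<^sup>2 / (4 * (L + 1)))"
      using L by (intro mult_left_mono) auto
    also have "\<dots> \<le> \<sigma>\<^sup>2 / 4"
      using L by (simp add: field_simps)
    finally show ?thesis .
  qed
  have u_le: "(\<sigma> * s)\<^sup>2 \<le> 1" if "\<bar>s\<bar> \<le> c" for s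
  proof -
    have "\<bar>s\<bar> \<le> 1 / \<sigma>" using that c by linarith
    hence "\<bar>\<sigma> * s\<bar> \<le> 1" using sigma by (simp add: abs_mult field_simps)
    thus ?thesis by (simp add: abs_square_le_1)
  qed
  have taylor: "norm (char M s - of_real (1 - (\<sigma> * s)\<^sup>2 / 2)) \<le> L * \<bar>s\<bar> powr (2 + \<delta>)" for s
    using char_taylor2[of s] by (simp add: L_def power_mult_distrib mult.commute)
  have "norm (char M s) \<le> exp (- (\<sigma> * s)\<^sup>2 / 4)" if "\<bar>s\<bar> \<le> c" for s
  proof -
    have "norm (char M s) \<le> norm (complex_of_real (1 - (\<sigma> * s)\<^sup>2 / 2)) + L * \<bar>s\<bar> powr (2 + \<delta>)"
      using taylor[of s] norm_triangle_sub[of "char M s" "of_real (1 - (\<sigma> * s)\<^sup>2 / 2)"] by linarith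
    also have "norm (complex_of_real (1 - (\<sigma> * s)\<^sup>2 / 2)) = 1 - (\<sigma> * s)\<^sup>2 / 2"
      unfolding norm_of_real using u_le[OF that] by simp
    also have "L * \<bar>s\<bar> powr (2 + \<delta>) = s\<^sup>2 * (L * \<bar>s\<bar> powr \<delta>)"
      by (cases "s = 0") (auto simp: powr_add)
    also have "\<dots> \<le> s\<^sup>2 * (\<sigma>\<^sup>2 / 4)"
      by (intro mult_left_mono small that) simp
    also have "1 - (\<sigma> * s)\<^sup>2 / 2 + s\<^sup>2 * (\<sigma>\<^sup>2 / 4) = 1 + - (\<sigma> * s)\<^sup>2 / 4"
      by (simp add: power_mult_distrib)
    also have "\<dots> \<le> exp (- (\<sigma> * s)\<^sup>2 / 4)"
      by (rule exp_ge_add_one_self)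
    finally show ?thesis by simp
  qed
  moreover have "norm (char M s - exp (- (\<sigma> * s)\<^sup>2 / 2)) \<le> (L + \<sigma> ^ 4) * \<bar>s\<bar> powr (2 + \<delta>)" if "\<bar>s\<bar> \<le> c" for s
  proof -
    have "norm (complex_of_real (exp (- (\<sigma> * s)\<^sup>2 / 2)) - of_real (1 - (\<sigma> * s)\<^sup>2 / 2)) \<le> ((\<sigma> * s)\<^sup>2 / 2)\<^sup>2"
      using abs_exp_minus_taylor1[of "(\<sigma> * s)\<^sup>2 / 2"]
      unfolding of_real_diff[symmetric] norm_of_real by simp
    also have "\<dots> = \<sigma> ^ 4 / 4 * s ^ 4"
      by (simp add: power_mult_distrib power_divide flip: power_mult)
    also have "\<dots> \<le> \<sigma> ^ 4 * \<bar>s\<bar> powr (2 + \<delta>)"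
    proof (cases "s = 0")
      case False
      have "s ^ 4 = \<bar>s\<bar> powr 4" using False by simp
      also have "\<dots> \<le> \<bar>s\<bar> powr (2 + \<delta>)"
        using that c delta by (intro powr_mono') auto
      finally show ?thesis by (intro mult_mono) auto
    qed simp
    finally have "norm (of_real (1 - (\<sigma> * s)\<^sup>2 / 2) - complex_of_real (exp (- (\<sigma> * s)\<^sup>2 / 2))) \<le> \<sigma> ^ 4 * \<bar>s\<bar> powr (2 + \<delta>)"
      by (simp only: norm_minus_commute)
    with taylor[of s] show ?thesis
      using norm_diff_triangle_le[of "char M s" "of_real (1 - (\<sigma> * s)\<^sup>2 / 2)" "L * \<bar>s\<bar> powr (2 + \<delta>)"]
      by (simp add: distrib_right)
  qed
  moreover have "0 < L + \<sigma> ^ 4" using L sigma by (simp add: add_nonneg_pos)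
  ultimately show ?thesis using c(1) that by blast
qed

text \<open>The Gaussian factor is itself an \<open>n\<close>-th power, so
  \<open>norm_power_diff_le\<close> reduces the claim to one factor, with
  \<open>r = exp (- (t\<^sup>2 / n) / 4)\<close>. For \<open>n \<ge> 2\<close> the exponent
  \<open>n - 1\<close> is at least \<open>n / 2\<close>, hence
  \<open>r ^ (n - 1) \<le> exp (- t\<^sup>2 / 8)\<close>. The factor \<open>n\<close> against
  \<open>\<bar>s\<bar> powr (2 + \<delta>)\<close> leaves the rate
  \<open>n powr (- \<delta> / 2)\<close>.\<close>

lemma char_power_near_gaussian:
  obtains c L where "0 < c" "0 < L"
    and "\<And>n t. 2 \<le> n \<Longrightarrow> \<bar>t\<bar> \<le> c * sqrt (real n) \<Longrightarrow>
      norm (char M (t / (\<sigma> * sqrt (real n))) ^ n - exp (- t\<^sup>2 / 2))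
        \<le> L * real n powr (- \<delta> / 2) * \<bar>t\<bar> powr (2 + \<delta>) * exp (- t\<^sup>2 / 8)"
proof -
  obtain c L where c: "0 < c" and L: "0 < L"
    and decay: "\<And>s. \<bar>s\<bar> \<le> c \<Longrightarrow> norm (char M s) \<le> exp (- (\<sigma> * s)\<^sup>2 / 4)"
    and approx: "\<And>s. \<bar>s\<bar> \<le> c \<Longrightarrow> norm (char M s - exp (- (\<sigma> * s)\<^sup>2 / 2)) \<le> L * \<bar>s\<bar> powr (2 + \<delta>)"
    using char_near_zero by blast
  have "norm (char M (t / (\<sigma> * sqrt (real n))) ^ n - exp (- t\<^sup>2 / 2))
        \<le> (L / \<sigma> powr (2 + \<delta>)) * real n powr (- \<delta> / 2) * \<bar>t\<bar> powr (2 + \<delta>) * exp (- t\<^sup>2 / 8)"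
    if n: "2 \<le> n" and t: "\<bar>t\<bar> \<le> c * \<sigma> * sqrt (real n)" for n :: nat and t
  proof -
    define s where "s = t / (\<sigma> * sqrt (real n))"
    have s: "\<bar>s\<bar> \<le> c"
      using t n sigma by (simp add: s_def abs_mult field_simps)
    have ss: "(\<sigma> * s)\<^sup>2 = t\<^sup>2 / real n"
      using sigma by (simp add: s_def power_divide)
    define r where "r = exp (- (t\<^sup>2 / real n) / 4)"
    define w where "w = exp (- (t\<^sup>2 / real n) / 2)"
    have "w \<le> r" using divide_left_mono[of 2 4 "t\<^sup>2 / real n"] by (simp add: w_def r_def)
    have "norm (char M s ^ n - of_real w ^ n) \<le> real n * r ^ (n - 1) * norm (char M s - of_real w)"
      using decay[OF s] \<open>w \<le> r\<close> by (intro norm_power_diff_le) (auto simp: ss r_def w_def)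
    also have "\<dots> \<le> real n * exp (- t\<^sup>2 / 8) * (L * \<bar>s\<bar> powr (2 + \<delta>))"
    proof (intro mult_mono)
      have "(1/2) \<le> real (n - 1) / real n"
        using n by (simp add: field_simps of_nat_diff)
      hence half: "(1/2) * (t\<^sup>2 / 4) \<le> (real (n - 1) / real n) * (t\<^sup>2 / 4)"
        by (rule mult_right_mono) simp
      have "r ^ (n - 1) = exp (- (t\<^sup>2 / 4) * (real (n - 1) / real n))"
        unfolding r_def exp_of_nat_mult[symmetric] by (simp add: mult.commute)
      also have "exp (- (t\<^sup>2 / 4) * (real (n - 1) / real n)) \<le> exp (- (t\<^sup>2 / 4) * (1 / 2))"
        using half by (simp only: exp_le_cancel_iff) (simp add: mult.commute)
      finally show "r ^ (n - 1) \<le> exp (- t\<^sup>2 / 8)" by simp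
      show "norm (char M s - of_real w) \<le> L * \<bar>s\<bar> powr (2 + \<delta>)"
        using approx[OF s] by (simp add: ss w_def)
    qed (auto simp: r_def)
    also have "\<bar>s\<bar> powr (2 + \<delta>) = \<bar>t\<bar> powr (2 + \<delta>) / (\<sigma> powr (2 + \<delta>) * real n powr (1 + \<delta> / 2))"
    proof -
      have "sqrt (real n) powr (2 + \<delta>) = real n powr (1 + \<delta> / 2)"
        using n by (simp add: powr_half_sqrt[symmetric] powr_powr add_divide_distrib)
      thus ?thesis using sigma by (simp add: s_def abs_mult powr_divide powr_mult)
    qed
    also have "real n * exp (- t\<^sup>2 / 8) * (L * (\<bar>t\<bar> powr (2 + \<delta>) / (\<sigma> powr (2 + \<delta>) * real n powr (1 + \<delta> / 2))))
       = (L / \<sigma> powr (2 + \<delta>)) * real n powr (- \<delta> / 2) * \<bar>t\<bar> powr (2 + \<delta>) * exp (- t\<^sup>2 / 8)"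
    proof -
      have "real n / real n powr (1 + \<delta> / 2) = real n powr (- \<delta> / 2)"
      proof -
        have "real n powr (1 + \<delta> / 2) = real n * real n powr (\<delta> / 2)"
          using n by (simp add: powr_add)
        thus ?thesis
          using n powr_minus_divide[of "real n" "\<delta> / 2"] by simp
      qed
      hence "L / \<sigma> powr (2 + \<delta>) * \<bar>t\<bar> powr (2 + \<delta>) * exp (- t\<^sup>2 / 8) * (real n / real n powr (1 + \<delta> / 2))
          = L / \<sigma> powr (2 + \<delta>) * \<bar>t\<bar> powr (2 + \<delta>) * exp (- t\<^sup>2 / 8) * real n powr (- \<delta> / 2)"
        by (rule arg_cong)
      thus ?thesis by (simp only: times_divide_eq_left times_divide_eq_right divide_divide_eq_left mult_ac)
    qed
    finally show ?thesis
      using n by (simp add: s_def w_def flip: exp_of_nat_mult of_real_power)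
  qed
  moreover have "0 < c * \<sigma>" "0 < L / \<sigma> powr (2 + \<delta>)" using c L sigma by simp_all
  ultimately show ?thesis using that by blast
qed

end

section \<open>A Berry--Esseen bound under moments of order \<open>2 + \<delta>\<close>\<close>

lemma cdf_std_normal_lipschitz:
  assumes "x \<le> y"
  shows "cdf std_normal_distribution y - cdf std_normal_distribution x \<le> y - x"
proof (cases "x = y")
  case False
  interpret N: real_distribution std_normal_distribution by (rule real_dist_normal_dist)
  have le: "std_normal_density t \<le> 1" for t
  proof -
    have "1 / sqrt (2 * pi) \<le> 1" using pi_ge_two by simp
    moreover have "exp (- t\<^sup>2 / 2) \<le> 1" by simp
    ultimately show ?thesis
      unfolding std_normal_density_def by (intro mult_le_one) auto
  qed
  have "emeasure std_normal_distribution {x<..y}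
      = (\<integral>\<^sup>+t. ennreal (std_normal_density t) * indicator {x<..y} t \<partial>lborel)"
    by (rule emeasure_density) auto
  also have "\<dots> \<le> (\<integral>\<^sup>+t. indicator {x<..y} t \<partial>lborel)"
    by (rule nn_integral_mono) (auto simp: le split: split_indicator)
  also have "\<dots> = ennreal (y - x)" using assms by simp
  finally have "N.prob {x<..y} \<le> y - x"
    using assms by (simp add: N.emeasure_eq_measure)
  thus ?thesis
    using False assms by (simp add: N.cdf_diff_eq)
qed simp

lemma gaussian_integral:
  fixes s :: real
  assumes "0 < s"
  shows "integrable lborel (\<lambda>t. exp (- t\<^sup>2 / (2 * s\<^sup>2)))"
    and "(LINT t|lborel. exp (- t\<^sup>2 / (2 * s\<^sup>2))) = s * sqrt (2 * pi)"
proof -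
  have eq: "exp (- t\<^sup>2 / (2 * s\<^sup>2)) = s * sqrt (2 * pi) * normal_density 0 s t" for t
    using assms by (simp add: normal_density_def real_sqrt_mult)
  show "integrable lborel (\<lambda>t. exp (- t\<^sup>2 / (2 * s\<^sup>2)))"
    unfolding eq using assms by simp
  show "(LINT t|lborel. exp (- t\<^sup>2 / (2 * s\<^sup>2))) = s * sqrt (2 * pi)"
    unfolding eq using assms by simp
qed

text \<open>Taking the image of the standard normal law under scaling lets the characteristic
  function, the absence of atoms and the mass bound follow by a change of variables.\<close>

definition centered_normal :: "real \<Rightarrow> real measure" where
  "centered_normal \<epsilon> = distr std_normal_distribution borel (\<lambda>x. \<epsilon> * x)"

lemma
  shows real_distribution_centered_normal: "real_distribution (centered_normal \<epsilon>)"
    and char_centered_normal: "char (centered_normal \<epsilon>) t = exp (- (\<epsilon> * t)\<^sup>2 / 2)"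
proof -
  interpret N: real_distribution std_normal_distribution by (rule real_dist_normal_dist)
  show "real_distribution (centered_normal \<epsilon>)"
    unfolding centered_normal_def by (rule N.real_distribution_distr) simp
  have "char (centered_normal \<epsilon>) t = char std_normal_distribution (t * \<epsilon>)"
    unfolding centered_normal_def char_def by (subst integral_distr) (auto simp: mult_ac)
  thus "char (centered_normal \<epsilon>) t = exp (- (\<epsilon> * t)\<^sup>2 / 2)"
    by (simp add: char_std_normal_distribution mult.commute)
qed

lemma centered_normal_atomless:
  assumes "0 < \<epsilon>"
  shows "measure (centered_normal \<epsilon>) {x} = 0"
proof -
  interpret N: real_distribution std_normal_distribution by (rule real_dist_normal_dist)
  have "(\<lambda>x. \<epsilon> * x) -` {x} = {x / \<epsilon>}"
    using assms by (auto simp: field_simps)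
  moreover have "emeasure std_normal_distribution {x / \<epsilon>} = 0"
    by (subst emeasure_density) (auto simp: nn_integral_indicator_singleton)
  ultimately show ?thesis
    unfolding centered_normal_def by (subst measure_distr) (auto simp: measure_def)
qed

text \<open>Chebyshev's inequality at two standard deviations; \<open>3/4\<close> is the mass that
  \<open>cdf_diff_le_smoothed_cdf_diff\<close> requires.\<close>

lemma centered_normal_mass:
  assumes "0 < \<epsilon>"
  shows "measure (centered_normal \<epsilon>) {- (2 * \<epsilon>)..2 * \<epsilon>} \<ge> 3/4"
proof -
  interpret N: real_distribution std_normal_distribution by (rule real_dist_normal_dist)
  have "N.expectation (\<lambda>x. x\<^sup>2) = 1"
    using std_normal_distribution_even_moments[of 1] by simp
  hence "N.prob {x \<in> space std_normal_distribution. \<bar>x\<bar> \<ge> 2} \<le> 1 / 2\<^sup>2"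
    using N.second_moment_method[of "\<lambda>x. x" 2] integrable_std_normal_distribution_moment[of 2] by simp
  moreover have "N.prob (UNIV - {x. 2 \<le> \<bar>x\<bar>}) = 1 - N.prob {x. 2 \<le> \<bar>x\<bar>}"
    using N.prob_compl[of "{x. 2 \<le> \<bar>x\<bar>}"] by simp
  moreover have "N.prob (UNIV - {x. 2 \<le> \<bar>x\<bar>}) \<le> N.prob {-2..2}"
    by (intro N.finite_measure_mono) (auto simp: abs_le_iff)
  ultimately have "3/4 \<le> N.prob {-2..2}" by (simp add: power2_eq_square)
  also have "{-2..2} = (\<lambda>x. \<epsilon> * x) -` {- (2 * \<epsilon>)..2 * \<epsilon>}"
  proof -
    have "- (2 * \<epsilon>) \<le> \<epsilon> * x \<longleftrightarrow> - 2 \<le> x" "\<epsilon> * x \<le> 2 * \<epsilon> \<longleftrightarrow> x \<le> 2" for x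
      using assms mult_le_cancel_left_pos[of \<epsilon> "-2" x] mult_le_cancel_left_pos[of \<epsilon> x 2]
      by (simp_all add: mult.commute)
    thus ?thesis by auto
  qed
  finally show ?thesis
    unfolding centered_normal_def by (subst measure_distr) auto
qed

text \<open>Given the \<open>M\<close>-component, the sum hits a point only if the
  \<open>V\<close>-component hits a point. Thus an atomless kernel removes every atom, as the
  inversion step requires.\<close>

lemma measure_convolution_singleton:
  assumes "real_distribution V" "real_distribution M" "\<And>x. measure V {x} = 0"
  shows "measure (V \<star> M) {x} = 0"
proof -
  interpret V: real_distribution V by fact
  interpret M: real_distribution M by fact
  have "emeasure (M \<star> V) {x} = (\<integral>\<^sup>+v. emeasure V {a. a + v \<in> {x}} \<partial>M)"
    by (rule convolution_emeasure) (auto simp: V.finite_measure_axioms M.finite_measure_axioms)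
  also have "\<dots> = (\<integral>\<^sup>+v. 0 \<partial>M)"
  proof (intro nn_integral_cong)
    fix v
    have "{a. a + v \<in> {x}} = {x - v}" by (auto simp: algebra_simps)
    thus "emeasure V {a. a + v \<in> {x}} = 0"
      using assms(3) by (simp add: V.emeasure_eq_measure)
  qed
  finally have "measure (M \<star> V) {x} = 0" by (simp add: measure_def)
  thus ?thesis
    by (subst convolution_commutative) (auto simp: V.finite_measure_axioms M.finite_measure_axioms)
qed

text \<open>Both laws are smoothed by the same Gaussian, which multiplies the difference of their
  characteristic functions by \<open>exp (- (\<epsilon> * t)\<^sup>2 / 2)\<close>. The term
  \<open>6 * \<epsilon>\<close> is the unsmoothing cost with Lipschitz constant \<open>1\<close> and
  \<open>b = 2 * \<epsilon>\<close>.\<close>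

lemma cdf_diff_std_normal_le:
  assumes P: "real_distribution P" and eps: "0 < \<epsilon>"
    and w: "integrable lborel w"
    and le_w: "\<And>t. norm (char P t - exp (- t\<^sup>2 / 2)) * exp (- (\<epsilon> * t)\<^sup>2 / 2) / \<bar>t\<bar> \<le> w t"
  shows "\<bar>cdf P x - cdf std_normal_distribution x\<bar> \<le> 2 / pi * (LINT t|lborel. w t) + 6 * \<epsilon>"
proof -
  let ?V = "centered_normal \<epsilon>" and ?N = "std_normal_distribution"
  note V = real_distribution_centered_normal[of \<epsilon>]
  note N = real_dist_normal_dist
  have "\<bar>cdf P x - cdf ?N x\<bar> \<le> 2 * ((LINT t|lborel. w t) / pi) + 3 * 1 * (2 * \<epsilon>)"
  proof (rule cdf_diff_le_smoothed_cdf_diff[OF V P N])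
    show "\<bar>cdf (?V \<star> P) y - cdf (?V \<star> ?N) y\<bar> \<le> (LINT t|lborel. w t) / pi" for y
    proof (rule cdf_diff_le_char_diff[OF _ _ _ _ w])
      fix t
      have "norm (char (?V \<star> P) t - char (?V \<star> ?N) t)
          = norm (char P t - exp (- t\<^sup>2 / 2)) * exp (- (\<epsilon> * t)\<^sup>2 / 2)"
        by (simp add: char_convolution V P N char_centered_normal char_std_normal_distribution
            norm_mult flip: right_diff_distrib)
      thus "norm (char (?V \<star> P) t - char (?V \<star> ?N) t) / \<bar>t\<bar> \<le> w t"
        using le_w[of t] by simp
    qed (auto intro!: real_distribution_convolution measure_convolution_singleton V P N
        centered_normal_atomless eps)
  qed (use eps cdf_std_normal_lipschitz centered_normal_mass in auto)
  thus ?thesis by simp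
qed

text \<open>The law \<open>P\<close> enters only through its characteristic function, so it may be
  the law of any normalized sum of \<open>n\<close> independent copies.\<close>

theorem (in centered_distribution) berry_esseen_cdf:
  assumes delta_half: "\<delta> \<le> 1/2"
  obtains C where "0 < C"
    and "\<And>n P x. 1 \<le> n \<Longrightarrow> real_distribution P \<Longrightarrow>
      (\<And>t. char P t = char M (t / (\<sigma> * sqrt (real n))) ^ n) \<Longrightarrow>
      \<bar>cdf P x - cdf std_normal_distribution x\<bar> \<le> C * real n powr (- \<delta> / 2)"
proof -
  obtain c L where c: "0 < c" and L: "0 < L"
    and gauss: "\<And>n t. 2 \<le> n \<Longrightarrow> \<bar>t\<bar> \<le> c * sqrt (real n) \<Longrightarrow>
      norm (char M (t / (\<sigma> * sqrt (real n))) ^ n - exp (- t\<^sup>2 / 2))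
        \<le> L * real n powr (- \<delta> / 2) * \<bar>t\<bar> powr (2 + \<delta>) * exp (- t\<^sup>2 / 8)"
    using char_power_near_gaussian by blast
  \<comment> \<open>The integrals of the two dominating functions \<open>w1\<close> and
    \<open>w2\<close> below, after each has been bounded by a multiple of
    \<open>\<epsilon>\<close>.\<close>
  define I where "I = 16 * L * (sqrt 8 * sqrt (2 * pi)) + 2 / c * sqrt (2 * pi)"
  have I: "0 < I" using c L by (simp add: I_def add_pos_pos)
  define C where "C = max 1 (2 / pi * I + 6)"
  have "\<bar>cdf P x - cdf std_normal_distribution x\<bar> \<le> C * real n powr (- \<delta> / 2)"
    if n: "1 \<le> n" and P: "real_distribution P"
      and char_P: "\<And>t. char P t = char M (t / (\<sigma> * sqrt (real n))) ^ n" for n P x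
  proof (cases "n = 1")
    case True
    interpret P: real_distribution P by fact
    interpret N: real_distribution std_normal_distribution by (rule real_dist_normal_dist)
    have "\<bar>cdf P x - cdf std_normal_distribution x\<bar> \<le> 1"
      using P.cdf_nonneg[of x] N.cdf_nonneg[of x] P.cdf_bounded_prob[of x] N.cdf_bounded_prob[of x]
      by (auto simp: abs_le_iff)
    thus ?thesis using True by (simp add: C_def)
  next
    case False
    with n have n: "2 \<le> n" by simp
    interpret P: real_distribution P by fact
    define \<epsilon> where "\<epsilon> = real n powr (- \<delta> / 2)"
    have eps: "0 < \<epsilon>" using n by (simp add: \<epsilon>_def)
    \<comment> \<open>\<open>w1\<close> dominates the frequencies up to \<open>c * sqrt n\<close>
      and \<open>w2\<close> those beyond. Both are written in the shape of
      \<open>gaussian_integral\<close>, with standard deviations \<open>sqrt 8\<close> and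
      \<open>1 / \<epsilon>\<close>.\<close>
    define w1 where "w1 t = 16 * L * \<epsilon> * exp (- t\<^sup>2 / (2 * (sqrt 8)\<^sup>2))" for t :: real
    define w2 where "w2 t = 2 / (c * sqrt (real n)) * exp (- t\<^sup>2 / (2 * (1 / \<epsilon>)\<^sup>2))" for t :: real
    have w2_eq: "w2 t = 2 / (c * sqrt (real n)) * exp (- (\<epsilon> * t)\<^sup>2 / 2)" for t
      using eps by (simp add: w2_def power_divide power_mult_distrib field_simps)
    have nonneg: "0 \<le> w1 t" "0 \<le> w2 t" for t
      using c L eps by (simp_all add: w1_def w2_def)
    have "norm (char P t - exp (- t\<^sup>2 / 2)) * exp (- (\<epsilon> * t)\<^sup>2 / 2) / \<bar>t\<bar> \<le> w1 t + w2 t" for t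
    proof (cases "t = 0")
      case True
      then show ?thesis using nonneg[of 0] by simp
    next
      case t: False
      show ?thesis
      proof (cases "\<bar>t\<bar> \<le> c * sqrt (real n)")
        case True
        \<comment> \<open>One factor \<open>\<bar>t\<bar>\<close> is kept to cancel the denominator.
          The rest of the power costs half of the decay
          \<open>exp (- t\<^sup>2 / 8)\<close>.\<close>
        have "\<bar>t\<bar> powr (2 + \<delta>) \<le> \<bar>t\<bar> * (16 * exp (t\<^sup>2 / 16))"
        proof -
          have "\<bar>t\<bar> powr (2 + \<delta>) = \<bar>t\<bar> * \<bar>t\<bar> powr (1 + \<delta>)"
            using t by (simp add: powr_add power2_eq_square)
          also have "\<bar>t\<bar> powr (1 + \<delta>) \<le> 1 + t\<^sup>2"
          proof (cases "\<bar>t\<bar> \<le> 1")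
            case True
            hence "\<bar>t\<bar> powr (1 + \<delta>) \<le> 1" using delta by (intro powr_le1) auto
            thus ?thesis by (simp add: add_increasing2)
          next
            case False
            hence "\<bar>t\<bar> powr (1 + \<delta>) \<le> \<bar>t\<bar> powr 2" using delta by (intro powr_mono) auto
            thus ?thesis using t by simp
          qed
          also have "\<dots> \<le> 16 * exp (t\<^sup>2 / 16)"
            using exp_ge_add_one_self[of "t\<^sup>2 / 16"] by linarith
          finally show ?thesis by (simp add: mult_left_mono)
        qed
        have "norm (char P t - exp (- t\<^sup>2 / 2)) * exp (- (\<epsilon> * t)\<^sup>2 / 2)
            \<le> norm (char P t - exp (- t\<^sup>2 / 2)) * 1"
          by (intro mult_left_mono) auto
        also have "\<dots> \<le> L * \<epsilon> * \<bar>t\<bar> powr (2 + \<delta>) * exp (- t\<^sup>2 / 8)"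
          using gauss[OF n True] by (simp add: char_P \<epsilon>_def)
        also have "\<dots> \<le> L * \<epsilon> * (\<bar>t\<bar> * (16 * exp (t\<^sup>2 / 16))) * exp (- t\<^sup>2 / 8)"
          by (intro mult_left_mono mult_right_mono \<open>\<bar>t\<bar> powr (2 + \<delta>) \<le> \<bar>t\<bar> * (16 * exp (t\<^sup>2 / 16))\<close>)
            (use L eps in auto)
        also have "\<dots> = \<bar>t\<bar> * (16 * L * \<epsilon> * (exp (t\<^sup>2 / 16) * exp (- t\<^sup>2 / 8)))"
          by simp
        also have "exp (t\<^sup>2 / 16) * exp (- t\<^sup>2 / 8) = exp (- t\<^sup>2 / (2 * (sqrt 8)\<^sup>2))"
          by (simp flip: exp_add)
        also have "16 * L * \<epsilon> * \<dots> = w1 t" by (simp add: w1_def)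
        finally have "norm (char P t - exp (- t\<^sup>2 / 2)) * exp (- (\<epsilon> * t)\<^sup>2 / 2) / \<bar>t\<bar> \<le> w1 t"
          using t by (simp add: field_simps)
        thus ?thesis using nonneg(2)[of t] by linarith
      next
        case False
        have "norm (char P t - exp (- t\<^sup>2 / 2)) \<le> norm (char P t) + norm (complex_of_real (exp (- t\<^sup>2 / 2)))"
          by (rule norm_triangle_ineq4)
        also have "\<dots> \<le> 1 + 1"
          by (intro add_mono P.cmod_char_le_1) (simp only: norm_of_real, simp)
        finally have "norm (char P t - exp (- t\<^sup>2 / 2)) * exp (- (\<epsilon> * t)\<^sup>2 / 2) / \<bar>t\<bar>
            \<le> 2 * exp (- (\<epsilon> * t)\<^sup>2 / 2) / (c * sqrt (real n))"
          using False c n by (intro frac_le mult_right_mono) auto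
        also have "\<dots> = w2 t" by (simp add: w2_eq)
        finally show ?thesis using nonneg(1)[of t] by linarith
      qed
    qed
    moreover have int1: "integrable lborel w1" and lint1: "(LINT t|lborel. w1 t) = 16 * L * \<epsilon> * (sqrt 8 * sqrt (2 * pi))"
      unfolding w1_def using gaussian_integral[of "sqrt 8"] by simp_all
    moreover have int2: "integrable lborel w2" and lint2: "(LINT t|lborel. w2 t) = 2 / (c * sqrt (real n)) * (1 / \<epsilon> * sqrt (2 * pi))"
      unfolding w2_def using gaussian_integral[of "1 / \<epsilon>"] eps by simp_all
    ultimately have "\<bar>cdf P x - cdf std_normal_distribution x\<bar> \<le> 2 / pi * (LINT t|lborel. w1 t + w2 t) + 6 * \<epsilon>"
      by (intro cdf_diff_std_normal_le[OF P eps]) auto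
    moreover have "(LINT t|lborel. w1 t + w2 t) \<le> I * \<epsilon>"
    proof -
      \<comment> \<open>The high-frequency integral has order
        \<open>n powr (- 1/2 + \<delta> / 2)\<close>; this is at most \<open>\<epsilon>\<close>
        because \<open>\<delta> \<le> 1/2\<close>.\<close>
      have "1 / (sqrt (real n) * \<epsilon>) \<le> \<epsilon>"
      proof -
        have "1 / (sqrt (real n) * \<epsilon>) = real n powr (- (1/2) + \<delta> / 2)"
        proof -
          have "\<epsilon> = 1 / real n powr (\<delta> / 2)"
            using powr_minus_divide[of "real n" "\<delta> / 2"] by (simp add: \<epsilon>_def)
          moreover have "real n powr (- (1/2)) = 1 / sqrt (real n)"
            using powr_minus_divide[of "real n" "1/2"] by (simp add: powr_half_sqrt)
          ultimately show ?thesis by (simp only: powr_add) simp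
        qed
        also have "\<dots> \<le> \<epsilon>"
          unfolding \<epsilon>_def using n delta_half by (intro powr_mono) auto
        finally show ?thesis .
      qed
      hence "2 / c * sqrt (2 * pi) * (1 / (sqrt (real n) * \<epsilon>)) \<le> 2 / c * sqrt (2 * pi) * \<epsilon>"
        using c by (intro mult_left_mono) auto
      thus ?thesis
        by (simp add: int1 int2 lint1 lint2 I_def ring_distribs mult_ac)
    qed
    hence "2 / pi * (LINT t|lborel. w1 t + w2 t) \<le> 2 / pi * (I * \<epsilon>)"
      by (rule mult_left_mono) simp
    ultimately have "\<bar>cdf P x - cdf std_normal_distribution x\<bar> \<le> (2 / pi * I + 6) * \<epsilon>"
      by (simp only: distrib_right mult.assoc)
    also have "\<dots> \<le> C * \<epsilon>"
      using eps by (intro mult_right_mono) (auto simp: C_def)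
    finally show ?thesis by (simp add: \<epsilon>_def)
  qed
  moreover have "0 < C" by (simp add: C_def)
  ultimately show ?thesis using that by blast
qed

section \<open>The divergence of the empirical distribution\<close>

text \<open>The law of \<open>J\<close> has density \<open>q\<close> with respect to counting
  measure. Integrability gives absolute summability, so the integral agrees with the unordered sum
  used for the entropy.\<close>

lemma (in prob_space) expectation_nat_valued:
  fixes f :: "nat \<Rightarrow> real"
  assumes J [measurable]: "J \<in> M \<rightarrow>\<^sub>M count_space UNIV"
    and q: "\<And>i. prob {\<omega> \<in> space M. J \<omega> = i} = q i"
    and int: "integrable M (\<lambda>\<omega>. f (J \<omega>))"
  shows "expectation (\<lambda>\<omega>. f (J \<omega>)) = (\<Sum>\<^sub>\<infinity>i. q i * f i)"
proof -
  have q_nonneg: "0 \<le> q i" for i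
    using q[of i] by (metis measure_nonneg)
  have distr: "distr M (count_space UNIV) J = density (count_space UNIV) (\<lambda>i. ennreal (q i))"
  proof (rule measure_eqI_countable[where A=UNIV])
    fix i
    have "emeasure (distr M (count_space UNIV) J) {i} = ennreal (q i)"
      by (subst emeasure_distr) (auto simp: emeasure_eq_measure vimage_def Int_def conj_commute simp flip: q)
    thus "emeasure (distr M (count_space UNIV) J) {i} = emeasure (density (count_space UNIV) (\<lambda>i. ennreal (q i))) {i}"
      by (simp add: emeasure_density nn_integral_count_space_indicator nn_integral_indicator_singleton)
  qed auto
  have "expectation (\<lambda>\<omega>. f (J \<omega>)) = integral\<^sup>L (distr M (count_space UNIV) J) f"
    by (subst integral_distr) auto
  also have "\<dots> = (LINT i|count_space UNIV. q i * f i)"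
    unfolding distr by (subst integral_density) (auto simp: q_nonneg)
  also have "\<dots> = infsetsum (\<lambda>i. q i * f i) UNIV"
    by (simp add: infsetsum_def)
  also have "\<dots> = (\<Sum>\<^sub>\<infinity>i. q i * f i)"
  proof (rule infsetsum_infsum)
    have "integrable (distr M (count_space UNIV) J) f"
      using int by (subst integrable_distr_eq) auto
    thus "Infinite_Set_Sum.abs_summable_on (\<lambda>i. q i * f i) UNIV"
      unfolding distr Infinite_Set_Sum.abs_summable_on_def
      by (subst (asm) integrable_density) (auto simp: q_nonneg)
  qed
  finally show ?thesis .
qed

text \<open>The sample is recorded by the indices of its letters. Equality of the laws is expressed
  by point masses \<open>q\<close> that do not depend on \<open>k\<close>, which determines a law on
  a countable set.\<close>

locale iid_nat = prob_space +
  fixes J :: "nat \<Rightarrow> 'a \<Rightarrow> nat" and q :: "nat \<Rightarrow> real"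
  assumes indep: "indep_vars (\<lambda>_. count_space UNIV) J {1..}"
    and q: "\<And>k i. 1 \<le> k \<Longrightarrow> prob {\<omega> \<in> space M. J k \<omega> = i} = q i"
begin

lemma J_measurable [measurable]: "1 \<le> k \<Longrightarrow> J k \<in> M \<rightarrow>\<^sub>M count_space UNIV"
  using indep by (auto simp: indep_vars_def)

lemma q_nonneg: "0 \<le> q i"
  using q[of 1 i] by (metis measure_nonneg order_refl)

lemma q_le_1: "q i \<le> 1"
  using q[of 1 i] by (metis prob_le_1 order_refl)

lemma sum_q_le_1:
  assumes "finite S"
  shows "sum q S \<le> 1"
proof -
  have "sum q S = (\<Sum>i\<in>S. prob {\<omega> \<in> space M. J 1 \<omega> = i})"
    by (simp add: q)
  also have "\<dots> = prob (\<Union>i\<in>S. {\<omega> \<in> space M. J 1 \<omega> = i})"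
    by (rule finite_measure_finite_Union[symmetric]) (auto simp: assms disjoint_family_on_def)
  finally show ?thesis by simp
qed

text \<open>Letters of probability zero contribute countably many null events. Outside them every
  \<open>ln (q (J k \<omega>))\<close> is a genuine logarithm rather than a default value.\<close>

lemma AE_q_pos:
  assumes "1 \<le> k"
  shows "AE \<omega> in M. 0 < q (J k \<omega>)"
proof -
  have "AE \<omega> in M. \<forall>i. q i = 0 \<longrightarrow> J k \<omega> \<noteq> i"
    unfolding AE_all_countable
  proof
    fix i
    show "AE \<omega> in M. q i = 0 \<longrightarrow> J k \<omega> \<noteq> i"
    proof (cases "q i = 0")
      case True
      hence "prob {\<omega> \<in> space M. J k \<omega> = i} = 0" using q assms by simp
      hence "AE \<omega> in M. \<omega> \<notin> {\<omega> \<in> space M. J k \<omega> = i}"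
        using assms by (subst AE_iff_measurable[OF _ refl]) (auto simp: emeasure_eq_measure)
      thus ?thesis using AE_space by eventually_elim simp
    qed simp
  qed
  thus ?thesis
    by eventually_elim (use q_nonneg in \<open>auto simp: less_le\<close>)
qed

lemma distr_J:
  assumes "1 \<le> k"
  shows "distr M (count_space UNIV) (J k) = distr M (count_space UNIV) (J 1)"
proof (rule measure_eqI_countable[where A=UNIV])
  have "emeasure (distr M (count_space UNIV) (J k)) {i} = ennreal (q i)" if "1 \<le> k" for k i
    using that q[OF that, of i]
    by (subst emeasure_distr) (auto simp: emeasure_eq_measure vimage_def Int_def conj_commute)
  thus "emeasure (distr M (count_space UNIV) (J k)) {i} = emeasure (distr M (count_space UNIV) (J 1)) {i}" for i
    using assms by simp
qed auto

lemma integrable_iff_J1: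
  fixes f :: "nat \<Rightarrow> real"
  assumes "1 \<le> k"
  shows "integrable M (\<lambda>\<omega>. f (J k \<omega>)) \<longleftrightarrow> integrable M (\<lambda>\<omega>. f (J 1 \<omega>))"
  using integrable_distr_eq[of "J k" M "count_space UNIV" f] integrable_distr_eq[of "J 1" M "count_space UNIV" f]
    distr_J[OF assms] assms by simp

lemma expectation_J:
  fixes f :: "nat \<Rightarrow> real"
  assumes "1 \<le> k" "integrable M (\<lambda>\<omega>. f (J 1 \<omega>))"
  shows "expectation (\<lambda>\<omega>. f (J k \<omega>)) = (\<Sum>\<^sub>\<infinity>i. q i * f i)"
  by (intro expectation_nat_valued J_measurable q assms(1) integrable_iff_J1[OF assms(1), THEN iffD2] assms(2))

lemma prob_pair:
  assumes "1 \<le> k" "1 \<le> j" "k \<noteq> j"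
  shows "prob {\<omega> \<in> space M. J k \<omega> = i \<and> J j \<omega> = i} = (q i)\<^sup>2"
proof -
  have "prob (\<Inter>l\<in>{k, j}. J l -` {i} \<inter> space M) = (\<Prod>l\<in>{k, j}. prob (J l -` {i} \<inter> space M))"
    using assms by (intro indep_varsD[OF indep]) auto
  also have "\<dots> = prob (J k -` {i} \<inter> space M) * prob (J j -` {i} \<inter> space M)"
    using assms by simp
  also have "\<dots> = (q i)\<^sup>2"
    using q[OF assms(1), of i] q[OF assms(2), of i]
    by (simp add: vimage_def Int_def conj_commute power2_eq_square)
  also have "(\<Inter>l\<in>{k, j}. J l -` {i} \<inter> space M) = {\<omega> \<in> space M. J k \<omega> = i \<and> J j \<omega> = i}"
    by auto
  finally show ?thesis .
qed

section \<open>Empirical frequencies and sample means\<close>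

definition freq :: "nat \<Rightarrow> nat \<Rightarrow> 'a \<Rightarrow> real" where
  "freq n i \<omega> = (\<Sum>k=1..n. of_bool (J k \<omega> = i)) / real n"

lemma freq_measurable [measurable]: "freq n i \<in> borel_measurable M"
proof -
  have "(\<lambda>\<omega>. \<Sum>k=1..n. of_bool (J k \<omega> = i) :: real) \<in> borel_measurable M"
    by (intro borel_measurable_sum) simp
  thus ?thesis unfolding freq_def[abs_def] by simp
qed

lemma freq_le_1: "freq n i \<omega> \<le> 1"
proof -
  have "(\<Sum>k=1..n. of_bool (J k \<omega> = i) :: real) \<le> (\<Sum>k=1..n. 1)"
    by (intro sum_mono) simp
  thus ?thesis by (simp add: freq_def divide_le_eq)
qed

lemma freq_pos:
  assumes "k \<in> {1..n}"
  shows "0 < freq n (J k \<omega>) \<omega>"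
proof -
  have "0 < (\<Sum>l=1..n. of_bool (J l \<omega> = J k \<omega>) :: real)"
    using assms by (intro sum_pos2[of _ k]) auto
  thus ?thesis using assms by (simp add: freq_def)
qed

text \<open>Grouping the positions of the sample by letter turns a sample mean into a
  frequency-weighted sum over letters. The set \<open>S\<close> may be larger than the sample, or
  omit letters where \<open>g\<close> vanishes.\<close>

lemma sum_over_sample:
  fixes g :: "nat \<Rightarrow> real"
  assumes "finite S" and "\<And>k. k \<in> {1..n} \<Longrightarrow> J k \<omega> \<notin> S \<Longrightarrow> g (J k \<omega>) = 0"
  shows "(\<Sum>k=1..n. g (J k \<omega>)) / real n = (\<Sum>i\<in>S. freq n i \<omega> * g i)"
proof -
  have "(\<Sum>k=1..n. g (J k \<omega>)) = (\<Sum>k=1..n. \<Sum>i\<in>S. of_bool (J k \<omega> = i) * g i)"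
    using assms by (intro sum.cong) (auto simp: sum.delta' of_bool_def if_distrib[of "\<lambda>x. x * _"] cong: if_cong)
  also have "\<dots> = (\<Sum>i\<in>S. (\<Sum>k=1..n. of_bool (J k \<omega> = i)) * g i)"
    by (subst sum.swap) (simp add: sum_distrib_right)
  finally show ?thesis
    by (simp add: freq_def sum_divide_distrib)
qed

text \<open>The divergence \<open>\<Sum>i. f\<^sub>i ln (f\<^sub>i / q\<^sub>i)\<close> of the empirical distribution \<open>f\<close> from \<open>q\<close>, written as a mean
  over the sample.\<close>

definition divergence :: "nat \<Rightarrow> 'a \<Rightarrow> real" where
  "divergence n \<omega> = (\<Sum>k=1..n. ln (freq n (J k \<omega>) \<omega>) - ln (q (J k \<omega>))) / real n"

text \<open>The first sum is the part of the frequency-weighted mean of \<open>f / q - 1\<close>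
  coming from indices below \<open>m\<close>, with \<open>f\<close> the frequency. Since
  \<open>f\<close> enters it at most quadratically and the second sum is a mean of functions of
  single observations, the expectation can be computed exactly.\<close>

definition divergence_bound :: "nat \<Rightarrow> nat \<Rightarrow> 'a \<Rightarrow> real" where
  "divergence_bound n m \<omega> =
    (\<Sum>i | i < m \<and> 0 < q i. (freq n i \<omega>)\<^sup>2 / q i - freq n i \<omega>)
      + (\<Sum>k=1..n. if J k \<omega> < m then 0 else - ln (q (J k \<omega>))) / real n"

lemma divergence_nonneg:
  assumes "1 \<le> n" and pos: "\<And>k. k \<in> {1..n} \<Longrightarrow> 0 < q (J k \<omega>)"
  shows "0 \<le> divergence n \<omega>"
proof -
  let ?S = "(\<lambda>k. J k \<omega>) ` {1..n}"
  have "(\<Sum>k=1..n. q (J k \<omega>) / freq n (J k \<omega>) \<omega>) / real n = (\<Sum>i\<in>?S. freq n i \<omega> * (q i / freq n i \<omega>))"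
    by (rule sum_over_sample) auto
  also have "\<dots> = sum q ?S"
    by (intro sum.cong) (auto simp: freq_pos less_imp_neq[OF freq_pos, symmetric])
  also have "\<dots> \<le> 1" by (rule sum_q_le_1) simp
  finally have "(\<Sum>k=1..n. q (J k \<omega>) / freq n (J k \<omega>) \<omega>) \<le> real n"
    using assms by (simp add: field_simps)
  hence "0 \<le> (\<Sum>k=1..n. 1 - q (J k \<omega>) / freq n (J k \<omega>) \<omega>)"
    by (simp add: sum_subtractf)
  also have "\<dots> \<le> (\<Sum>k=1..n. ln (freq n (J k \<omega>) \<omega>) - ln (q (J k \<omega>)))"
  proof (rule sum_mono)
    fix k assume k: "k \<in> {1..n}"
    have "ln (q (J k \<omega>) / freq n (J k \<omega>) \<omega>) \<le> q (J k \<omega>) / freq n (J k \<omega>) \<omega> - 1"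
      using freq_pos[OF k, of \<omega>] pos[OF k] by (intro ln_le_minus_one) simp
    thus "1 - q (J k \<omega>) / freq n (J k \<omega>) \<omega> \<le> ln (freq n (J k \<omega>) \<omega>) - ln (q (J k \<omega>))"
      using freq_pos[OF k, of \<omega>] pos[OF k] by (simp add: ln_div)
  qed
  finally show ?thesis by (simp add: divergence_def)
qed

lemma divergence_le_bound:
  assumes pos: "\<And>k. k \<in> {1..n} \<Longrightarrow> 0 < q (J k \<omega>)"
  shows "divergence n \<omega> \<le> divergence_bound n m \<omega>"
proof -
  let ?g = "\<lambda>i. if i < m \<and> 0 < q i then freq n i \<omega> / q i - 1 else 0"
  let ?h = "\<lambda>i. if i < m then 0 else - ln (q i)"
  have "(\<Sum>k=1..n. ln (freq n (J k \<omega>) \<omega>) - ln (q (J k \<omega>))) \<le> (\<Sum>k=1..n. ?g (J k \<omega>) + ?h (J k \<omega>))"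
  proof (rule sum_mono)
    fix k assume k: "k \<in> {1..n}"
    note p = freq_pos[OF k, of \<omega>] pos[OF k]
    show "ln (freq n (J k \<omega>) \<omega>) - ln (q (J k \<omega>)) \<le> ?g (J k \<omega>) + ?h (J k \<omega>)"
    proof (cases "J k \<omega> < m")
      case True
      have "ln (freq n (J k \<omega>) \<omega> / q (J k \<omega>)) \<le> freq n (J k \<omega>) \<omega> / q (J k \<omega>) - 1"
        using p by (intro ln_le_minus_one) simp
      thus ?thesis using p True by (simp add: ln_div)
    next
      case False
      thus ?thesis using p freq_le_1[of n "J k \<omega>" \<omega>] by simp
    qed
  qed
  hence "divergence n \<omega> \<le> (\<Sum>k=1..n. ?g (J k \<omega>)) / real n + (\<Sum>k=1..n. ?h (J k \<omega>)) / real n"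
    unfolding divergence_def sum.distrib add_divide_distrib[symmetric] by (intro divide_right_mono) auto
  also have "(\<Sum>k=1..n. ?g (J k \<omega>)) / real n = (\<Sum>i | i < m \<and> 0 < q i. freq n i \<omega> * ?g i)"
    by (rule sum_over_sample) auto
  also have "\<dots> = (\<Sum>i | i < m \<and> 0 < q i. (freq n i \<omega>)\<^sup>2 / q i - freq n i \<omega>)"
    by (intro sum.cong) (auto simp: power2_eq_square algebra_simps)
  finally show ?thesis by (simp add: divergence_bound_def)
qed

lemma
  assumes "1 \<le> n"
  shows expectation_freq: "expectation (freq n i) = q i"
    and expectation_freq_square: "expectation (\<lambda>\<omega>. (freq n i \<omega>)\<^sup>2) = (q i)\<^sup>2 + (q i - (q i)\<^sup>2) / real n"
    and integrable_freq: "integrable M (freq n i)"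
    and integrable_freq_square: "integrable M (\<lambda>\<omega>. (freq n i \<omega>)\<^sup>2)"
proof -
  let ?c = "\<lambda>k \<omega>. of_bool (J k \<omega> = i) :: real"
  have int1: "integrable M (?c k)" if "1 \<le> k" for k
    using that by (intro integrable_const_bound[of _ 1]) auto
  have int2: "integrable M (\<lambda>\<omega>. ?c k \<omega> * ?c j \<omega>)" if "1 \<le> k" "1 \<le> j" for k j
    using that by (intro integrable_const_bound[of _ 1]) auto
  have e1: "expectation (?c k) = q i" if "1 \<le> k" for k
  proof -
    have "expectation (?c k) = expectation (indicator {\<omega> \<in> space M. J k \<omega> = i})"
      by (intro Bochner_Integration.integral_cong) (auto simp: indicator_def)
    thus ?thesis using that q by simp
  qed
  have e2: "expectation (\<lambda>\<omega>. ?c k \<omega> * ?c j \<omega>) = (if k = j then q i - (q i)\<^sup>2 else 0) + (q i)\<^sup>2"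
    if "1 \<le> k" "1 \<le> j" for k j
  proof (cases "k = j")
    case True
    have "(\<lambda>\<omega>. ?c k \<omega> * ?c j \<omega>) = ?c k" using True by auto
    thus ?thesis using True e1 that by simp
  next
    case False
    have "expectation (\<lambda>\<omega>. ?c k \<omega> * ?c j \<omega>) = expectation (indicator {\<omega> \<in> space M. J k \<omega> = i \<and> J j \<omega> = i})"
      by (intro Bochner_Integration.integral_cong) (auto simp: indicator_def)
    thus ?thesis using that False prob_pair[of k j i] by simp
  qed
  show "integrable M (freq n i)"
    unfolding freq_def using int1 by (intro integrable_divide Bochner_Integration.integrable_sum) auto
  have square: "(freq n i \<omega>)\<^sup>2 = (\<Sum>k=1..n. \<Sum>j=1..n. ?c k \<omega> * ?c j \<omega>) / (real n)\<^sup>2" for \<omega>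
    unfolding freq_def power_divide power2_eq_square by (subst sum_product[symmetric]) simp
  show "integrable M (\<lambda>\<omega>. (freq n i \<omega>)\<^sup>2)"
    unfolding square using int2 by (intro integrable_divide Bochner_Integration.integrable_sum) auto
  show "expectation (freq n i) = q i"
  proof -
    have "expectation (freq n i) = (\<Sum>k=1..n. expectation (?c k)) / real n"
      unfolding freq_def integral_divide_zero using int1
      by (subst Bochner_Integration.integral_sum) auto
    also have "\<dots> = q i" using assms by (simp add: e1)
    finally show ?thesis .
  qed
  show "expectation (\<lambda>\<omega>. (freq n i \<omega>)\<^sup>2) = (q i)\<^sup>2 + (q i - (q i)\<^sup>2) / real n"
  proof -
    have "expectation (\<lambda>\<omega>. (freq n i \<omega>)\<^sup>2)
        = (\<Sum>k=1..n. \<Sum>j=1..n. expectation (\<lambda>\<omega>. ?c k \<omega> * ?c j \<omega>)) / (real n)\<^sup>2"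
    proof -
      have "expectation (\<lambda>\<omega>. \<Sum>k=1..n. \<Sum>j=1..n. ?c k \<omega> * ?c j \<omega>)
          = (\<Sum>k=1..n. expectation (\<lambda>\<omega>. \<Sum>j=1..n. ?c k \<omega> * ?c j \<omega>))"
        by (intro Bochner_Integration.integral_sum Bochner_Integration.integrable_sum int2) auto
      also have "\<dots> = (\<Sum>k=1..n. \<Sum>j=1..n. expectation (\<lambda>\<omega>. ?c k \<omega> * ?c j \<omega>))"
        by (intro sum.cong refl Bochner_Integration.integral_sum int2) auto
      finally show ?thesis unfolding square integral_divide_zero by (rule arg_cong)
    qed
    also have "(\<Sum>k=1..n. \<Sum>j=1..n. expectation (\<lambda>\<omega>. ?c k \<omega> * ?c j \<omega>))
        = (\<Sum>k=1..n. \<Sum>j=1..n. (if k = j then q i - (q i)\<^sup>2 else 0) + (q i)\<^sup>2)"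
      by (intro sum.cong refl e2) auto
    also have "\<dots> = real n * (q i - (q i)\<^sup>2) + (real n)\<^sup>2 * (q i)\<^sup>2"
      by (simp add: sum.distrib power2_eq_square ring_distribs)
    finally show ?thesis
      using assms by (simp only: add_divide_distrib power2_eq_square) simp
  qed
qed

lemma
  assumes n: "1 \<le> n" and ln_q: "integrable M (\<lambda>\<omega>. ln (q (J 1 \<omega>)))"
  shows integrable_divergence_bound: "integrable M (divergence_bound n m)"
    and expectation_divergence_bound:
      "expectation (divergence_bound n m) \<le> real m / real n - (\<Sum>\<^sub>\<infinity>i\<in>{m..}. q i * ln (q i))"
proof -
  let ?I = "{i. i < m \<and> 0 < q i}"
  let ?h = "\<lambda>i. if i < m then 0 else - ln (q i)"
  have int_h1: "integrable M (\<lambda>\<omega>. ?h (J 1 \<omega>))"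
    by (rule Bochner_Integration.integrable_bound[OF ln_q]) auto
  have int_h: "integrable M (\<lambda>\<omega>. ?h (J k \<omega>))" if "1 \<le> k" for k
    using int_h1 integrable_iff_J1[OF that, of ?h] by simp
  have int_U: "integrable M (\<lambda>\<omega>. \<Sum>i\<in>?I. (freq n i \<omega>)\<^sup>2 / q i - freq n i \<omega>)"
    using integrable_freq[OF n] integrable_freq_square[OF n] by simp
  have int_V: "integrable M (\<lambda>\<omega>. (\<Sum>k=1..n. ?h (J k \<omega>)) / real n)"
    using int_h by (intro integrable_divide Bochner_Integration.integrable_sum) auto
  show "integrable M (divergence_bound n m)"
    unfolding divergence_bound_def[abs_def] by (rule Bochner_Integration.integrable_add[OF int_U int_V])
  have "expectation (divergence_bound n m)
      = expectation (\<lambda>\<omega>. \<Sum>i\<in>?I. (freq n i \<omega>)\<^sup>2 / q i - freq n i \<omega>)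
        + expectation (\<lambda>\<omega>. (\<Sum>k=1..n. ?h (J k \<omega>)) / real n)"
    unfolding divergence_bound_def[abs_def] by (rule Bochner_Integration.integral_add[OF int_U int_V])
  also have "expectation (\<lambda>\<omega>. \<Sum>i\<in>?I. (freq n i \<omega>)\<^sup>2 / q i - freq n i \<omega>)
      = (\<Sum>i\<in>?I. ((q i)\<^sup>2 + (q i - (q i)\<^sup>2) / real n) / q i - q i)"
    using integrable_freq[OF n] integrable_freq_square[OF n]
    by (subst Bochner_Integration.integral_sum) (auto simp: expectation_freq[OF n] expectation_freq_square[OF n])
  also have "\<dots> = (\<Sum>i\<in>?I. (1 - q i) / real n)"
    using n by (intro sum.cong) (auto simp: field_simps power2_eq_square)
  also have "\<dots> \<le> (\<Sum>i<m. 1 / real n)"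
    using q_nonneg q_le_1
    by (intro order_trans[OF sum_mono sum_mono2]) (auto intro!: divide_right_mono)
  also have "expectation (\<lambda>\<omega>. (\<Sum>k=1..n. ?h (J k \<omega>)) / real n) = (\<Sum>\<^sub>\<infinity>i. q i * ?h i)"
  proof -
    have "expectation (\<lambda>\<omega>. (\<Sum>k=1..n. ?h (J k \<omega>)) / real n) = (\<Sum>k=1..n. expectation (\<lambda>\<omega>. ?h (J k \<omega>))) / real n"
      unfolding integral_divide_zero using int_h by (subst Bochner_Integration.integral_sum) auto
    also have "\<dots> = (\<Sum>k=1..n. (\<Sum>\<^sub>\<infinity>i. q i * ?h i)) / real n"
      by (intro arg_cong2[where f="(/)"] sum.cong refl expectation_J int_h1) auto
    finally show ?thesis using n by simp
  qed
  also have "(\<Sum>\<^sub>\<infinity>i. q i * ?h i) = (\<Sum>\<^sub>\<infinity>i\<in>{m..}. - (q i * ln (q i)))"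
    by (rule infsum_cong_neutral) auto
  also have "\<dots> = - (\<Sum>\<^sub>\<infinity>i\<in>{m..}. q i * ln (q i))"
    by (rule infsum_uminus)
  finally show "expectation (divergence_bound n m) \<le> real m / real n - (\<Sum>\<^sub>\<infinity>i\<in>{m..}. q i * ln (q i))"
    by simp
qed

end

section \<open>The plug-in entropy\<close>

lemma (in prob_space) std_normal_perturbation:
  assumes [measurable]: "T \<in> borel_measurable M" "W \<in> borel_measurable M" "R \<in> borel_measurable M"
    and TW: "AE \<omega> in M. W \<omega> - R \<omega> \<le> T \<omega> \<and> T \<omega> \<le> W \<omega>"
    and W: "\<And>y. \<bar>cdf (distr M borel W) y - cdf std_normal_distribution y\<bar> \<le> b"
    and eps: "0 < \<epsilon>"
  shows "\<bar>prob {\<omega> \<in> space M. T \<omega> < x} - cdf std_normal_distribution x\<bar>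
    \<le> b + \<epsilon> + prob {\<omega> \<in> space M. \<epsilon> \<le> R \<omega>}"
proof -
  have cdf_W: "cdf (distr M borel W) y = prob {\<omega> \<in> space M. W \<omega> \<le> y}" for y
    unfolding cdf_def by (subst measure_distr) (auto intro!: arg_cong[where f=prob])
  have "prob {\<omega> \<in> space M. T \<omega> < x}
      \<le> prob ({\<omega> \<in> space M. W \<omega> \<le> x + \<epsilon>} \<union> {\<omega> \<in> space M. \<epsilon> \<le> R \<omega>})"
    using TW by (intro finite_measure_mono_AE) auto
  also have "\<dots> \<le> prob {\<omega> \<in> space M. W \<omega> \<le> x + \<epsilon>} + prob {\<omega> \<in> space M. \<epsilon> \<le> R \<omega>}"
    by (rule measure_Un_le) auto
  finally have upper: "prob {\<omega> \<in> space M. T \<omega> < x}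
      \<le> cdf (distr M borel W) (x + \<epsilon>) + prob {\<omega> \<in> space M. \<epsilon> \<le> R \<omega>}"
    by (simp add: cdf_W)
  have "prob {\<omega> \<in> space M. W \<omega> \<le> x - \<epsilon>} \<le> prob {\<omega> \<in> space M. T \<omega> < x}"
    using TW eps by (intro finite_measure_mono_AE) auto
  hence lower: "cdf (distr M borel W) (x - \<epsilon>) \<le> prob {\<omega> \<in> space M. T \<omega> < x}"
    by (simp add: cdf_W)
  show ?thesis
    using upper lower W[of "x + \<epsilon>"] W[of "x - \<epsilon>"] eps
      cdf_std_normal_lipschitz[of x "x + \<epsilon>"] cdf_std_normal_lipschitz[of "x - \<epsilon>" x]
      measure_nonneg[of M "{\<omega> \<in> space M. \<epsilon> \<le> R \<omega>}"]
    by linarith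
qed

lemma (in prob_space) integrable_powr_shift:
  fixes f :: "'a \<Rightarrow> real"
  assumes [measurable]: "f \<in> borel_measurable M" and "0 \<le> r"
    and "integrable M (\<lambda>x. \<bar>f x\<bar> powr r)"
  shows "integrable M (\<lambda>x. \<bar>f x - c\<bar> powr r)"
proof (rule Bochner_Integration.integrable_bound)
  show "integrable M (\<lambda>x. 2 powr r * (\<bar>f x\<bar> powr r + \<bar>c\<bar> powr r))"
    using assms by simp
  have "\<bar>y - c\<bar> powr r \<le> 2 powr r * (\<bar>y\<bar> powr r + \<bar>c\<bar> powr r)" for y
  proof -
    have "\<bar>y - c\<bar> powr r \<le> (2 * max \<bar>y\<bar> \<bar>c\<bar>) powr r"
      using assms by (intro powr_mono2) auto
    also have "\<dots> = 2 powr r * (max \<bar>y\<bar> \<bar>c\<bar>) powr r"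
      by (rule powr_mult)
    also have "\<dots> \<le> 2 powr r * (\<bar>y\<bar> powr r + \<bar>c\<bar> powr r)"
      by (intro mult_left_mono) (auto simp: max_def)
    finally show ?thesis .
  qed
  thus "AE x in M. norm (\<bar>f x - c\<bar> powr r) \<le> norm (2 powr r * (\<bar>f x\<bar> powr r + \<bar>c\<bar> powr r))"
    by (intro AE_I2) (simp add: abs_mult)
qed simp

context iid_nat
begin

lemma berry_esseen_log_likelihood:
  assumes delta: "0 < \<delta>" "\<delta> \<le> 1/2" and sigma: "0 < \<sigma>"
    and moment: "integrable M (\<lambda>\<omega>. \<bar>ln (q (J 1 \<omega>))\<bar> powr (2 + \<delta>))"
    and H: "H = - expectation (\<lambda>\<omega>. ln (q (J 1 \<omega>)))"
    and var: "\<sigma>\<^sup>2 = variance (\<lambda>\<omega>. ln (q (J 1 \<omega>)))"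
  obtains C where "0 < C"
    and "\<And>n x. 1 \<le> n \<Longrightarrow>
      \<bar>cdf (distr M borel (\<lambda>\<omega>. (\<Sum>k=1..n. - ln (q (J k \<omega>)) - H) / (\<sigma> * sqrt (real n)))) x
        - cdf std_normal_distribution x\<bar> \<le> C * real n powr (- \<delta> / 2)"
proof -
  define Y where "Y k \<omega> = - ln (q (J k \<omega>)) - H" for k \<omega>
  have Y_meas [measurable]: "Y k \<in> borel_measurable M" if "1 \<le> k" for k
    unfolding Y_def[abs_def] using that by simp
  define \<mu> where "\<mu> = distr M borel (Y 1)"
  have sq: "integrable M (\<lambda>\<omega>. (ln (q (J 1 \<omega>)))\<^sup>2)"
    using moment delta by (intro square_integrable_of_powr[where \<delta>=\<delta> and f="\<lambda>\<omega>. ln (q (J 1 \<omega>))"]) auto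
  have int: "integrable M (\<lambda>\<omega>. ln (q (J 1 \<omega>)))"
    by (rule square_integrable_imp_integrable[OF _ sq]) simp
  have mean: "expectation (Y 1) = 0"
    using int by (simp add: Y_def[abs_def] H prob_space)
  have var_Y: "variance (Y 1) = \<sigma>\<^sup>2"
  proof -
    have "variance (Y 1) = expectation (\<lambda>\<omega>. (Y 1 \<omega>)\<^sup>2)" by (simp only: mean diff_0_right)
    also have "\<dots> = variance (\<lambda>\<omega>. ln (q (J 1 \<omega>)))"
      by (intro Bochner_Integration.integral_cong) (auto simp: Y_def H power2_eq_square algebra_simps)
    finally show ?thesis using var by simp
  qed
  have moment_Y: "integrable M (\<lambda>\<omega>. \<bar>Y 1 \<omega>\<bar> powr (2 + \<delta>))"
  proof -
    have "integrable M (\<lambda>\<omega>. \<bar>- ln (q (J 1 \<omega>)) - H\<bar> powr (2 + \<delta>))"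
      using moment delta by (intro integrable_powr_shift) auto
    thus ?thesis by (simp add: Y_def)
  qed
  interpret \<mu>: real_distribution \<mu>
    unfolding \<mu>_def by (rule real_distribution_distr) simp
  interpret \<mu>: centered_distribution \<mu> \<delta> \<sigma>
  proof
    show "integrable \<mu> (\<lambda>x. \<bar>x\<bar> powr (2 + \<delta>))"
      unfolding \<mu>_def using moment_Y by (subst integrable_distr_eq) auto
    have mean_mu: "\<mu>.expectation (\<lambda>x. x) = 0"
      unfolding \<mu>_def using mean by (subst integral_distr) auto
    thus "\<mu>.expectation (\<lambda>x. x) = 0" .
    show "\<mu>.variance (\<lambda>x. x) = \<sigma>\<^sup>2"
      unfolding mean_mu unfolding \<mu>_def using var_Y mean by (subst integral_distr) auto
  qed (fact delta(1), use delta in linarith, fact sigma)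
  obtain C where C: "0 < C" and BE: "\<And>n P x. 1 \<le> n \<Longrightarrow> real_distribution P \<Longrightarrow>
      (\<And>t. char P t = char \<mu> (t / (\<sigma> * sqrt (real n))) ^ n) \<Longrightarrow>
      \<bar>cdf P x - cdf std_normal_distribution x\<bar> \<le> C * real n powr (- \<delta> / 2)"
    using \<mu>.berry_esseen_cdf[OF delta(2)] by blast
  have "\<bar>cdf (distr M borel (\<lambda>\<omega>. (\<Sum>k=1..n. Y k \<omega>) / (\<sigma> * sqrt (real n)))) x
        - cdf std_normal_distribution x\<bar> \<le> C * real n powr (- \<delta> / 2)" if n: "1 \<le> n" for n x
  proof (rule BE[OF n])
    have meas: "(\<lambda>\<omega>. (\<Sum>k=1..n. Y k \<omega>)) \<in> borel_measurable M"
      by (intro borel_measurable_sum Y_meas) simp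
    thus "real_distribution (distr M borel (\<lambda>\<omega>. (\<Sum>k=1..n. Y k \<omega>) / (\<sigma> * sqrt (real n))))"
      by (intro real_distribution_distr) simp
    fix t
    have "char (distr M borel (\<lambda>\<omega>. (\<Sum>k=1..n. Y k \<omega>) / (\<sigma> * sqrt (real n)))) t
        = char (distr M borel (\<lambda>\<omega>. \<Sum>k=1..n. Y k \<omega>)) (t / (\<sigma> * sqrt (real n)))"
      unfolding char_def using meas by (simp add: integral_distr)
    also have "\<dots> = (\<Prod>k=1..n. char (distr M borel (Y k)) (t / (\<sigma> * sqrt (real n))))"
    proof (rule char_distr_sum)
      have "indep_vars (\<lambda>_. count_space UNIV) J {1..n}"
        by (rule indep_vars_subset[OF indep]) auto
      hence "indep_vars (\<lambda>_. borel) (\<lambda>k \<omega>. - ln (q (J k \<omega>)) - H) {1..n}"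
        by (rule indep_vars_compose2) simp
      thus "indep_vars (\<lambda>_. borel) Y {1..n}"
        by (simp add: Y_def[abs_def])
    qed
    also have "\<dots> = (\<Prod>k=1..n. char \<mu> (t / (\<sigma> * sqrt (real n))))"
    proof (intro prod.cong refl)
      fix k assume k: "k \<in> {1..n}"
      have "distr M borel (Y k) = distr (distr M (count_space UNIV) (J k)) borel (\<lambda>i. - ln (q i) - H)"
        if "1 \<le> k" for k
        using that by (subst distr_distr) (auto simp: comp_def Y_def[abs_def])
      hence "distr M borel (Y k) = \<mu>"
        using k distr_J[of k] by (simp add: \<mu>_def)
      thus "char (distr M borel (Y k)) (t / (\<sigma> * sqrt (real n))) = char \<mu> (t / (\<sigma> * sqrt (real n)))"
        by simp
    qed
    finally show "char (distr M borel (\<lambda>\<omega>. (\<Sum>k=1..n. Y k \<omega>) / (\<sigma> * sqrt (real n)))) t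
        = char \<mu> (t / (\<sigma> * sqrt (real n))) ^ n"
      by simp
  qed
  thus ?thesis using that[OF C] by (simp add: Y_def)
qed

definition sample_entropy :: "nat \<Rightarrow> 'a \<Rightarrow> real" where
  "sample_entropy n \<omega> = - (\<Sum>k=1..n. ln (freq n (J k \<omega>) \<omega>)) / real n"

lemma sample_entropy_measurable [measurable]: "sample_entropy n \<in> borel_measurable M"
proof -
  have "(\<lambda>\<omega>. ln (freq n (J k \<omega>) \<omega>)) \<in> borel_measurable M" if "1 \<le> k" for k
    using that by (intro measurable_compose_countable[where g="J k" and f="\<lambda>i \<omega>. ln (freq n i \<omega>)"]) simp_all
  hence "(\<lambda>\<omega>. \<Sum>k=1..n. ln (freq n (J k \<omega>) \<omega>)) \<in> borel_measurable M"
    by (intro borel_measurable_sum) simp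
  thus ?thesis unfolding sample_entropy_def[abs_def] by simp
qed

theorem berry_esseen_sample_entropy:
  fixes K :: "nat \<Rightarrow> nat"
  assumes delta: "0 < \<delta>" "\<delta> \<le> 1/2" and sigma: "0 < \<sigma>"
    and moment: "integrable M (\<lambda>\<omega>. \<bar>ln (q (J 1 \<omega>))\<bar> powr (2 + \<delta>))"
    and H: "H = - (\<Sum>\<^sub>\<infinity>i. q i * ln (q i))"
    and var: "\<sigma>\<^sup>2 = variance (\<lambda>\<omega>. ln (q (J 1 \<omega>)))"
    and K: "\<And>n. 1 \<le> n \<Longrightarrow> real (K n) \<le> real n powr (1/2 - \<delta>)"
    and tail: "\<And>n. 1 \<le> n \<Longrightarrow>
      - (real n powr (1/2 + \<delta>)) * (\<Sum>\<^sub>\<infinity>i\<in>{K n..}. q i * ln (q i)) \<le> C0"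
  obtains C where "0 < C"
    and "\<And>n x. 1 \<le> n \<Longrightarrow>
      \<bar>prob {\<omega> \<in> space M. sqrt (real n) * (sample_entropy n \<omega> - H) / \<sigma> < x}
        - cdf std_normal_distribution x\<bar> \<le> C * real n powr (- \<delta> / 2)"
proof -
  have sq: "integrable M (\<lambda>\<omega>. (ln (q (J 1 \<omega>)))\<^sup>2)"
    using moment delta by (intro square_integrable_of_powr[where \<delta>=\<delta> and f="\<lambda>\<omega>. ln (q (J 1 \<omega>))"]) auto
  have int: "integrable M (\<lambda>\<omega>. ln (q (J 1 \<omega>)))"
    by (rule square_integrable_imp_integrable[OF _ sq]) simp
  have H': "H = - expectation (\<lambda>\<omega>. ln (q (J 1 \<omega>)))"
    using expectation_J[of 1 "\<lambda>i. ln (q i)"] int by (simp add: H)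
  obtain C1 where C1: "0 < C1" and BE: "\<And>n x. 1 \<le> n \<Longrightarrow>
      \<bar>cdf (distr M borel (\<lambda>\<omega>. (\<Sum>k=1..n. - ln (q (J k \<omega>)) - H) / (\<sigma> * sqrt (real n)))) x
        - cdf std_normal_distribution x\<bar> \<le> C1 * real n powr (- \<delta> / 2)"
    using berry_esseen_log_likelihood[OF delta sigma moment H' var] by blast
  define C where "C = C1 + 1 + (1 + \<bar>C0\<bar>) / \<sigma>"
  have "\<bar>prob {\<omega> \<in> space M. sqrt (real n) * (sample_entropy n \<omega> - H) / \<sigma> < x}
        - cdf std_normal_distribution x\<bar> \<le> C * real n powr (- \<delta> / 2)" if n: "1 \<le> n" for n x
  proof -
    define T where "T \<omega> = sqrt (real n) * (sample_entropy n \<omega> - H) / \<sigma>" for \<omega>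
    define W where "W \<omega> = (\<Sum>k=1..n. - ln (q (J k \<omega>)) - H) / (\<sigma> * sqrt (real n))" for \<omega>
    define R where "R \<omega> = sqrt (real n) / \<sigma> * divergence_bound n (K n) \<omega>" for \<omega>
    define \<epsilon> where "\<epsilon> = real n powr (- \<delta> / 2)"
    have eps: "0 < \<epsilon>" using n by (simp add: \<epsilon>_def)
    have [measurable]: "T \<in> borel_measurable M" unfolding T_def[abs_def] by simp
    have [measurable]: "W \<in> borel_measurable M"
      unfolding W_def[abs_def] by (intro borel_measurable_divide borel_measurable_sum) simp_all
    have int_R: "integrable M R"
      unfolding R_def[abs_def] using integrable_divergence_bound[OF n int] by simp
    hence [measurable]: "R \<in> borel_measurable M" by simp
    have T_eq: "T \<omega> = W \<omega> - sqrt (real n) / \<sigma> * divergence n \<omega>" for \<omega>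
    proof -
      have "sample_entropy n \<omega> - H = (\<Sum>k=1..n. - ln (q (J k \<omega>)) - H) / real n - divergence n \<omega>"
        using n by (simp add: sample_entropy_def divergence_def sum_subtractf sum_negf field_simps)
      hence "T \<omega> = sqrt (real n) / \<sigma> * ((\<Sum>k=1..n. - ln (q (J k \<omega>)) - H) / real n) - sqrt (real n) / \<sigma> * divergence n \<omega>"
        by (simp add: T_def right_diff_distrib diff_divide_distrib)
      also have "sqrt (real n) / \<sigma> * ((\<Sum>k=1..n. - ln (q (J k \<omega>)) - H) / real n) = W \<omega>"
        using n real_div_sqrt[of "real n"] by (simp add: W_def divide_simps)
      finally show ?thesis .
    qed
    have "AE \<omega> in M. \<forall>k\<in>{1..n}. 0 < q (J k \<omega>)"
      by (rule AE_finite_allI) (auto intro: AE_q_pos)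
    hence ae: "AE \<omega> in M. 0 \<le> divergence n \<omega> \<and> divergence n \<omega> \<le> divergence_bound n (K n) \<omega>"
      by eventually_elim (use n in \<open>auto intro!: divergence_nonneg divergence_le_bound\<close>)
    have ae_T: "AE \<omega> in M. W \<omega> - R \<omega> \<le> T \<omega> \<and> T \<omega> \<le> W \<omega>"
      using ae by eventually_elim (use sigma in \<open>auto simp: T_eq R_def intro!: mult_left_mono divide_right_mono\<close>)
    have ae_R: "AE \<omega> in M. 0 \<le> R \<omega>"
      using ae by eventually_elim (use sigma in \<open>auto simp: R_def\<close>)
    have "expectation R = sqrt (real n) / \<sigma> * expectation (divergence_bound n (K n))"
      by (simp add: R_def[abs_def])
    also have "\<dots> \<le> sqrt (real n) / \<sigma> * ((1 + \<bar>C0\<bar>) * real n powr (- (1/2) - \<delta>))"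
    proof (rule mult_left_mono)
      have "expectation (divergence_bound n (K n)) \<le> real (K n) / real n - (\<Sum>\<^sub>\<infinity>i\<in>{K n..}. q i * ln (q i))"
        by (rule expectation_divergence_bound[OF n int])
      moreover have "real (K n) / real n \<le> real n powr (- (1/2) - \<delta>)"
      proof -
        have "real (K n) / real n \<le> real n powr (1/2 - \<delta>) / real n powr 1"
          using K[OF n] n by (simp add: divide_right_mono)
        also have "\<dots> = real n powr (- (1/2) - \<delta>)"
          unfolding powr_diff[symmetric] by (rule arg_cong[where f="\<lambda>e. real n powr e"]) simp
        finally show ?thesis .
      qed
      moreover have "- (\<Sum>\<^sub>\<infinity>i\<in>{K n..}. q i * ln (q i)) \<le> \<bar>C0\<bar> * real n powr (- (1/2) - \<delta>)"
      proof -
        have "real n powr (1/2 + \<delta>) * - (\<Sum>\<^sub>\<infinity>i\<in>{K n..}. q i * ln (q i)) \<le> \<bar>C0\<bar>"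
          using tail[OF n] by simp
        hence "- (\<Sum>\<^sub>\<infinity>i\<in>{K n..}. q i * ln (q i)) \<le> \<bar>C0\<bar> / real n powr (1/2 + \<delta>)"
          using n by (simp add: pos_le_divide_eq mult.commute)
        also have "\<dots> = \<bar>C0\<bar> * real n powr (- (1/2 + \<delta>))"
          by (simp only: powr_minus_divide times_divide_eq_right mult_1_right)
        finally show ?thesis by simp
      qed
      ultimately show "expectation (divergence_bound n (K n)) \<le> (1 + \<bar>C0\<bar>) * real n powr (- (1/2) - \<delta>)"
        unfolding distrib_right by linarith
    qed (use sigma in simp)
    also have "\<dots> = (1 + \<bar>C0\<bar>) / \<sigma> * (real n powr (1/2) * real n powr (- (1/2) - \<delta>))"
      by (simp add: powr_half_sqrt)
    also have "real n powr (1/2) * real n powr (- (1/2) - \<delta>) = \<epsilon> * \<epsilon>"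
      by (simp add: \<epsilon>_def flip: powr_add)
    finally have ER: "expectation R \<le> (1 + \<bar>C0\<bar>) / \<sigma> * (\<epsilon> * \<epsilon>)" .
    have "prob {\<omega> \<in> space M. \<epsilon> \<le> R \<omega>} \<le> expectation R / \<epsilon>"
      using ae_R eps by (intro integral_Markov_inequality_measure[OF int_R, of "{}"]) auto
    also have "\<dots> \<le> (1 + \<bar>C0\<bar>) / \<sigma> * \<epsilon>"
      using ER eps by (simp add: pos_divide_le_eq mult.assoc)
    finally have "prob {\<omega> \<in> space M. \<epsilon> \<le> R \<omega>} \<le> (1 + \<bar>C0\<bar>) / \<sigma> * \<epsilon>" .
    moreover have "\<bar>prob {\<omega> \<in> space M. T \<omega> < x} - cdf std_normal_distribution x\<bar>
        \<le> C1 * \<epsilon> + \<epsilon> + prob {\<omega> \<in> space M. \<epsilon> \<le> R \<omega>}"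
      using ae_T eps BE[OF n] by (intro std_normal_perturbation) (simp_all add: W_def[abs_def] \<epsilon>_def)
    ultimately have "\<bar>prob {\<omega> \<in> space M. T \<omega> < x} - cdf std_normal_distribution x\<bar> \<le> C * \<epsilon>"
      by (simp add: C_def distrib_right)
    thus ?thesis by (simp add: T_def \<epsilon>_def)
  qed
  moreover have "0 < C" using C1 sigma by (simp add: C_def add_pos_pos)
  ultimately show ?thesis using that by blast
qed

end

theorem theorem3p1:
  fixes M :: "'w measure"
    and X :: "nat \<Rightarrow> 'w \<Rightarrow> 'b"
    and a :: "nat \<Rightarrow> 'b"
    and p :: "nat \<Rightarrow> real"
    and K :: "nat \<Rightarrow> nat"
    and \<delta> C0 H \<sigma> :: real
  assumes delta: "0 < \<delta>" "\<delta> < 1/2"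
    and prob_space: "prob_space M"
    and alphabet: "inj_on a {1..}"
    and indep: "prob_space.indep_vars M (\<lambda>_. count_space (a ` {1..})) X {1..}"
    and ident: "\<And>n. n \<ge> 1 \<Longrightarrow>
      distr M (count_space (a ` {1..})) (X n) = distr M (count_space (a ` {1..})) (X 1)"
    and p: "\<And>i. i \<ge> 1 \<Longrightarrow> p i = point_prob M (X 1) (a i)"
    and nonuniform: "\<exists>i\<ge>1. \<exists>j\<ge>1. p i > 0 \<and> p j > 0 \<and> p i \<noteq> p j"
    and moment: "integrable M (\<lambda>\<omega>. \<bar>ln (point_prob M (X 1) (X 1 \<omega>))\<bar> powr (2 + \<delta>))"
    and K_pos: "\<And>n. n \<ge> 1 \<Longrightarrow> K n \<ge> 1"
    and K_le: "\<And>n. n \<ge> 1 \<Longrightarrow> real (K n) \<le> real n powr (1/2 - \<delta>)"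
    and tail_prob: "\<And>n. n \<ge> 1 \<Longrightarrow>
      real n powr (1/2 + \<delta>) * ln (real n) * (\<Sum>\<^sub>\<infinity>i\<in>{K n..}. p i) \<le> C0"
    and tail_entropy: "\<And>n. n \<ge> 1 \<Longrightarrow>
      - (real n powr (1/2 + \<delta>)) * (\<Sum>\<^sub>\<infinity>i\<in>{K n..}. p i * ln (p i)) \<le> C0"
    and H: "H = series_entropy p"
    and sigma: "\<sigma>\<^sup>2 = prob_space.variance M (\<lambda>\<omega>. ln (point_prob M (X 1) (X 1 \<omega>)))" "\<sigma> > 0"
  shows "\<exists>C>0. \<forall>n\<ge>1.
    (\<Squnion>x::real. \<bar>measure M {\<omega> \<in> space M. sqrt (real n) * (plugin_entropy a X n \<omega> - H) / \<sigma> < x}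
                 - cdf std_normal_distribution x\<bar>)
      \<le> C * real n powr (- \<delta> / 2)"
proof -
  interpret prob_space M by fact
  define inv_a where "inv_a = the_inv_into {1..} a"
  define J where "J k \<omega> = inv_a (X k \<omega>)" for k \<omega>
  define q where "q i = (if 1 \<le> i then p i else 0)" for i
  have X_meas: "X k \<in> M \<rightarrow>\<^sub>M count_space (a ` {1..})" if "1 \<le> k" for k
    using indep that by (auto simp: indep_vars_def)
  have X_in: "X k \<omega> \<in> a ` {1..}" if "1 \<le> k" "\<omega> \<in> space M" for k \<omega>
    using measurable_space[OF X_meas[OF that(1)] that(2)] by simp
  have inv_a: "inv_a (a i) = i" if "1 \<le> i" for i
    using alphabet that by (simp add: inv_a_def the_inv_into_f_f)
  have J_pos: "1 \<le> J k \<omega>" and a_J: "a (J k \<omega>) = X k \<omega>" if "1 \<le> k" "\<omega> \<in> space M" for k \<omega>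
    using X_in[OF that] inv_a by (auto simp: J_def)
  have J_eq_iff: "J k \<omega> = i \<longleftrightarrow> X k \<omega> = a i" if "1 \<le> k" "\<omega> \<in> space M" "1 \<le> i" for k \<omega> i
    using a_J[OF that(1,2)] inv_a[OF that(3)] by (auto simp: J_def)
  interpret iid_nat M J q
  proof
    show "indep_vars (\<lambda>_. count_space UNIV) J {1..}"
      unfolding J_def[abs_def] by (rule indep_vars_compose2[OF indep]) simp
    fix k i :: nat assume k: "1 \<le> k"
    show "prob {\<omega> \<in> space M. J k \<omega> = i} = q i"
    proof (cases "1 \<le> i")
      case True
      have eq: "prob {\<omega> \<in> space M. X k \<omega> = a i} = measure (distr M (count_space (a ` {1..})) (X k)) {a i}"
        if "1 \<le> k" for k
        using X_meas[OF that] True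
        by (subst measure_distr) (auto simp: vimage_def Int_def conj_commute)
      have "prob {\<omega> \<in> space M. J k \<omega> = i} = prob {\<omega> \<in> space M. X k \<omega> = a i}"
        using J_eq_iff k True by (metis (mono_tags, lifting))
      also have "\<dots> = prob {\<omega> \<in> space M. X 1 \<omega> = a i}"
        using eq[OF k] eq[of 1] ident[OF k] by simp
      also have "\<dots> = q i"
        using True by (simp add: q_def p point_prob_def)
      finally show ?thesis .
    next
      case False
      hence "{\<omega> \<in> space M. J k \<omega> = i} = {}"
        using J_pos[OF k] by fastforce
      hence "prob {\<omega> \<in> space M. J k \<omega> = i} = 0"
        by (simp only: measure_empty)
      thus ?thesis using False by (simp add: q_def)
    qed
  qed
  have point: "point_prob M (X 1) (X 1 \<omega>) = q (J 1 \<omega>)" if "\<omega> \<in> space M" for \<omega>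
    using p[OF J_pos[of 1 \<omega>]] J_pos[of 1 \<omega>] a_J[of 1 \<omega>] that by (simp add: q_def)
  have moment_q: "integrable M (\<lambda>\<omega>. \<bar>ln (q (J 1 \<omega>))\<bar> powr (2 + \<delta>))"
    using moment by (rule Bochner_Integration.integrable_cong[THEN iffD1, rotated 2]) (simp_all add: point del: One_nat_def)
  have mean_q: "expectation (\<lambda>\<omega>. ln (point_prob M (X 1) (X 1 \<omega>))) = expectation (\<lambda>\<omega>. ln (q (J 1 \<omega>)))"
    by (intro Bochner_Integration.integral_cong) (simp_all add: point del: One_nat_def)
  have var_q: "\<sigma>\<^sup>2 = variance (\<lambda>\<omega>. ln (q (J 1 \<omega>)))"
    unfolding sigma(1) mean_q by (intro Bochner_Integration.integral_cong) (simp_all add: point del: One_nat_def)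
  have H_q: "H = - (\<Sum>\<^sub>\<infinity>i. q i * ln (q i))"
    unfolding H series_entropy_def
    by (intro arg_cong[where f=uminus] infsum_cong_neutral) (auto simp: q_def)
  have tail_q: "- (real n powr (1/2 + \<delta>)) * (\<Sum>\<^sub>\<infinity>i\<in>{K n..}. q i * ln (q i)) \<le> C0" if "1 \<le> n" for n
  proof -
    have "(\<Sum>\<^sub>\<infinity>i\<in>{K n..}. q i * ln (q i)) = (\<Sum>\<^sub>\<infinity>i\<in>{K n..}. p i * ln (p i))"
      using K_pos[OF that] by (intro infsum_cong) (auto simp: q_def)
    thus ?thesis using tail_entropy[OF that] by simp
  qed
  obtain C where C: "0 < C" and bound: "\<And>n x. 1 \<le> n \<Longrightarrow>
      \<bar>prob {\<omega> \<in> space M. sqrt (real n) * (sample_entropy n \<omega> - H) / \<sigma> < x}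
        - cdf std_normal_distribution x\<bar> \<le> C * real n powr (- \<delta> / 2)"
    using berry_esseen_sample_entropy[OF delta(1) less_imp_le[OF delta(2)] sigma(2) moment_q H_q var_q K_le tail_q]
    by blast
  have plugin: "plugin_entropy a X n \<omega> = sample_entropy n \<omega>" if n: "1 \<le> n" and \<omega>: "\<omega> \<in> space M" for n \<omega>
  proof -
    have freq: "empirical_freq X n \<omega> (a i) = freq n i \<omega>" if "1 \<le> i" for i
    proof -
      have "(\<Sum>k=1..n. indicator {\<omega>'. X k \<omega>' = a i} \<omega>) = (\<Sum>k=1..n. of_bool (J k \<omega> = i) :: real)"
        using that \<omega> by (intro sum.cong refl) (auto simp: indicator_def J_eq_iff)
      thus ?thesis by (simp add: empirical_freq_def freq_def)
    qed
    let ?S = "(\<lambda>k. J k \<omega>) ` {1..n}"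
    have zero: "freq n i \<omega> = 0" if "i \<notin> ?S" for i
      using that by (auto simp: freq_def intro!: sum.neutral)
    have "(\<Sum>\<^sub>\<infinity>i\<in>{1..}. empirical_freq X n \<omega> (a i) * ln (empirical_freq X n \<omega> (a i)))
        = (\<Sum>\<^sub>\<infinity>i\<in>?S. freq n i \<omega> * ln (freq n i \<omega>))"
      using J_pos \<omega> by (intro infsum_cong_neutral) (auto simp: freq zero)
    also have "\<dots> = (\<Sum>i\<in>?S. freq n i \<omega> * ln (freq n i \<omega>))"
      by simp
    also have "\<dots> = (\<Sum>k=1..n. ln (freq n (J k \<omega>) \<omega>)) / real n"
      by (rule sum_over_sample[symmetric]) auto
    finally show ?thesis
      by (simp add: plugin_entropy_def series_entropy_def sample_entropy_def)
  qed
  have "(\<Squnion>x::real. \<bar>measure M {\<omega> \<in> space M. sqrt (real n) * (plugin_entropy a X n \<omega> - H) / \<sigma> < x}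
                 - cdf std_normal_distribution x\<bar>) \<le> C * real n powr (- \<delta> / 2)" if n: "1 \<le> n" for n
  proof (rule cSUP_least)
    fix x :: real
    have "{\<omega> \<in> space M. sqrt (real n) * (plugin_entropy a X n \<omega> - H) / \<sigma> < x}
        = {\<omega> \<in> space M. sqrt (real n) * (sample_entropy n \<omega> - H) / \<sigma> < x}"
      using plugin[OF n] by auto
    thus "\<bar>measure M {\<omega> \<in> space M. sqrt (real n) * (plugin_entropy a X n \<omega> - H) / \<sigma> < x}
                 - cdf std_normal_distribution x\<bar> \<le> C * real n powr (- \<delta> / 2)"
      using bound[OF n, of x] by simp
  qed simp
  thus ?thesis using C by blast
qed

end
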